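(* There exists a constant $C>1$ such that for Lebesgue-almost every $(x,y)\in[0,1]^2$, $$\lim_{k\to\infty}\frac1k\log\overline{q_{k,y}}(x)=C.$$ However, for every $C>1$, for Lebesgue-almost every $(x,y)\in[0,1]^2$, $$\liminf_{n\to\infty}\frac{q_{n,y}(x)}{C^n}=0.$$
   Context: Let $T(x)=\frac1x-\lfloor\frac1x\rfloor$ and, up to a Lebesgue-null set, $$\hat T_{slow}(x,y)=\begin{cases}\left(T(1-x),\frac{y}{1-x}\right), & 0\le y\le 1-x \text{ (red step)},\\ \left(T(x),\frac{1-y}{x}\right), & 1-x\le y\le 1\text{ (green step)}.\end{cases}$$ Write $(x_n,y_n)=\hat T_{slow}^n(x,y)$, and let $\hat a_{n+1}=\lfloor 1/x_n\rfloor$ if the step from $n$ to $n+1$ is green, $\hat a_{n+1}=\lfloor 1/(1-x_n)\rfloor$ if it is red. Thus $x_n=\frac1{\hat a_{n+1}+x_{n+1}}$ (green) or $x_n=1-\frac{1}{\hat a_{n+1}+x_{n+1}}$ (red), and successive substitution yields the semi-regular continued fraction $x=d_0+\cfrac{\varepsilon_0}{d_1+\cfrac{\varepsilon_1}{d_2+\ddots}}$ determined by $y$, where $\varepsilon_n=1$ if the step from $n$ to $n+1$ is green, $\varepsilon_n=-1$ if it is red, $d_0=\frac{1-\varepsilon_0}2$, and $d_n=\hat a_n+\frac{1-\varepsilon_n}{2}$ for $n\ge1$. $q_{n,y}(x)=q_n$ denotes the denominator of the $n$-th convergent of this expansion: $q_{-1}=0$, $q_0=1$, $q_n=d_nq_{n-1}+\varepsilon_{n-1}q_{n-2}$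 for $n\ge1$. Let $F=\{(x,y): y\ge1-x\text{ or }x>1/2\}$, $N_F(x,y)=\min\{n\ge0:\hat T_{slow}^n(x,y)\in F\}$ and $\hat T_{fast}(x,y)=\hat T_{slow}^{N_F(x,y)+1}(x,y)$. Let $n_0=0$ and $n_{k+1}=n_k+N_F(\hat T_{fast}^k(x,y))+1$, so that $\hat T_{fast}^k(x,y)=\hat T_{slow}^{n_k}(x,y)$. Define $\overline{q_{k,y}}(x)=q_{n_k,y}(x)$. *)

theory Defs
  imports "HOL-Analysis.Analysis"
begin

definition gauss_map :: "real \<Rightarrow> real" where
  "gauss_map x = 1 / x - of_int \<lfloor>1 / x\<rfloor>"

text \<open>
  The red branch is \<open>0 \<le> y \<le> 1 - x\<close> and the green branch is \<open>1 - x \<le> y \<le> 1\<close>; the two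
  overlap in the null set \<open>y = 1 - x\<close>, where we choose green, in accordance with \<open>F_set\<close> below.
\<close>

definition green :: "real \<times> real \<Rightarrow> bool" where
  "green = (\<lambda>(x, y). y \<ge> 1 - x)"

definition T_slow :: "real \<times> real \<Rightarrow> real \<times> real" where
  "T_slow = (\<lambda>(x, y). if green (x, y) then (gauss_map x, (1 - y) / x)
                       else (gauss_map (1 - x), y / (1 - x)))"

definition eps :: "real \<times> real \<Rightarrow> nat \<Rightarrow> int" where
  "eps p n = (if green ((T_slow ^^ n) p) then 1 else -1)"

definition xseq :: "real \<times> real \<Rightarrow> nat \<Rightarrow> real" where
  "xseq p n = fst ((T_slow ^^ n) p)"

text \<open>\<open>ahat p (Suc n)\<close> is read off from the step from \<open>n\<close> to \<open>n + 1\<close>; the value at \<open>0\<close> is never used.\<close>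

fun ahat :: "real \<times> real \<Rightarrow> nat \<Rightarrow> int" where
  "ahat p 0 = 0"
| "ahat p (Suc n) = (if green ((T_slow ^^ n) p) then \<lfloor>1 / xseq p n\<rfloor> else \<lfloor>1 / (1 - xseq p n)\<rfloor>)"

text \<open>The division by \<open>2\<close> is exact, as \<open>eps p n\<close> is \<open>1\<close> or \<open>-1\<close>.\<close>

definition dig :: "real \<times> real \<Rightarrow> nat \<Rightarrow> int" where
  "dig p n = (if n = 0 then (1 - eps p 0) div 2 else ahat p n + (1 - eps p n) div 2)"

text \<open>
  Denominators of the convergents of
  \<open>dig p 0 + eps p 0 / (dig p 1 + eps p 1 / (dig p 2 + \<dots>))\<close>, with the index shifted by one so that
  the recursion can start at \<open>q\<^sub>-\<^sub>1 = 0\<close>: \<open>q_shift p m\<close> is \<open>q\<^sub>m\<^sub>-\<^sub>1\<close>.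
\<close>

fun q_shift :: "real \<times> real \<Rightarrow> nat \<Rightarrow> int" where
  "q_shift p 0 = 0"
| "q_shift p (Suc 0) = 1"
| "q_shift p (Suc (Suc n)) = dig p (Suc n) * q_shift p (Suc n) + eps p n * q_shift p n"

definition q :: "real \<times> real \<Rightarrow> nat \<Rightarrow> int" where
  "q p n = q_shift p (Suc n)"

definition F_set :: "(real \<times> real) set" where
  "F_set = {(x, y). y \<ge> 1 - x \<or> x > 1 / 2}"

text \<open>\<open>N_F p\<close> is unspecified if the orbit of \<open>p\<close> never hits \<open>F_set\<close>.\<close>

definition N_F :: "real \<times> real \<Rightarrow> nat" where
  "N_F p = (LEAST n. (T_slow ^^ n) p \<in> F_set)"

definition T_fast :: "real \<times> real \<Rightarrow> real \<times> real" where
  "T_fast p = (T_slow ^^ (N_F p + 1)) p"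

fun nidx :: "real \<times> real \<Rightarrow> nat \<Rightarrow> nat" where
  "nidx p 0 = 0"
| "nidx p (Suc k) = nidx p k + N_F ((T_fast ^^ k) p) + 1"

definition qbar :: "real \<times> real \<Rightarrow> nat \<Rightarrow> int" where
  "qbar p k = q p (nidx p k)"

end

theory Submission
  imports Defs "HOL-Real_Asymp.Real_Asymp"
begin

text \<open>
  Let \<open>r\<close> be \<open>x\<close> or \<open>1 - x\<close> according to the colour of a slow step. This is the factor by which the
  inverse of the step contracts vertical segments. Along an orbit the product of these factors is
  \<open>1 / (c * x\<^sub>n + d)\<close>, where \<open>c\<close> and \<open>d\<close> are nonnegative integers and the denominator \<open>q\<^sub>n\<close> is \<open>d\<close> or
  \<open>c + d\<close> (\<open>prod_slow_ratio_denominator\<close>). Directly after a step that starts in \<open>F_set\<close> one has \<open>c \<le> d\<close>, so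
  at fast times \<open>ln q\<^sub>n\<close> differs by at most \<open>ln 2\<close> from a sum of the function \<open>- ln fast_ratio\<close> along the orbit
  of the fast map (\<open>ln_qbar_approx\<close>). The first claim is thus an instance of the ergodic theorem, with
  \<open>C\<close> the mean of \<open>- ln fast_ratio\<close>.

  The fast map has a closed form in terms of the Gauss map (\<open>fast_map\<close>): the square is divided into countably
  many pieces, each of which it maps projectively onto the whole square. This gives an explicit
  transfer operator. The bounded density \<open>(2 + x) / (1 + x)^2\<close> is a fixed point, by telescoping sums
  (\<open>transfer_inv_density\<close>). All denominators of inverse branches have uniformly bounded distortion, so the operator
  improves the modulus of continuity of log-Lipschitz densities towards a universal bound
  (\<open>log_lipschitz_transfer\<close>). Consequently an invariant set takes a definite share of every density,
  and is null or conull (\<open>fast_map_ergodic\<close>). The ergodic theorem itself is proved for ergodic maps only, by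
  a short argument with running maxima (\<open>birkhoff_ergodic\<close>).

  The constant exceeds 1 because \<open>- ln fast_ratio \<ge> - ln x\<close>: the function \<open>- ln x\<close> has Lebesgue mean 1 on the
  unit interval, and an even larger mean for the invariant density, which decreases in \<open>x\<close>
  (\<open>measure_inv_measure\<close>).

  For the second claim, near \<open>x = 0\<close> a fast step consists of about \<open>1 / x\<close> slow steps, and this is not
  integrable (\<open>nn_integral_red_run\<close>). So the number \<open>n\<^sub>k\<close> of slow steps in \<open>k\<close> fast steps satisfies
  \<open>n\<^sub>k / k \<rightarrow> \<infinity>\<close> almost everywhere, whereas \<open>ln q\<close> at time \<open>n\<^sub>k\<close> grows only linearly in \<open>k\<close>. Hence
  \<open>q\<^sub>n / C ^ n\<close> tends to 0 along the times \<open>n\<^sub>k\<close>.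
\<close>

section \<open>Birkhoff averages of an ergodic map\<close>

lemma birkhoff_sum_Suc:
  fixes f :: "'a \<Rightarrow> real"
  shows "(\<Sum>i<Suc n. f ((T ^^ i) x)) = f x + (\<Sum>i<n. f ((T ^^ i) (T x)))"
  by (simp add: sum.lessThan_Suc_shift funpow_Suc_right del: sum.lessThan_Suc funpow.simps)

lemma measurable_funpow:
  assumes "T \<in> measurable M M"
  shows "(T ^^ n) \<in> measurable M M"
proof (induction n)
  case (Suc n) then show ?case using measurable_comp[OF Suc assms] by (simp add: comp_def)
qed simp

context
  fixes M :: "'a measure" and T :: "'a \<Rightarrow> 'a"
  assumes finM: "finite_measure M"
    and T_meas [measurable]: "T \<in> measurable M M"
    and T_inv: "distr M M T = M"
    and erg: "\<And>A. A \<in> sets M \<Longrightarrow> T -` A \<inter> space M = A \<Longrightarrow>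
              emeasure M A = 0 \<or> emeasure M (space M - A) = 0"
begin

lemma integrable_comp_invariant:
  fixes g :: "'a \<Rightarrow> real"
  assumes "integrable M g"
  shows "integrable M (\<lambda>x. g (T x))" "(\<integral>x. g (T x) \<partial>M) = (\<integral>x. g x \<partial>M)"
proof -
  have "integrable (distr M M T) g" using assms by (simp add: T_inv)
  then show "integrable M (\<lambda>x. g (T x))" by (simp add: integrable_distr[OF T_meas])
  have "(\<integral>x. g (T x) \<partial>M) = (\<integral>x. g x \<partial>distr M M T)"
    using assms by (intro integral_distr[symmetric]) auto
  then show "(\<integral>x. g (T x) \<partial>M) = (\<integral>x. g x \<partial>M)" by (simp add: T_inv)
qed

text \<open>
  Where the sums \<open>S n\<close> are unbounded, their running maxima \<open>m n = max {S 1, \<dots>, S (n + 1)}\<close> satisfy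
  \<open>m (n + 1) - m n \<circ> T = f\<close> for large \<open>n\<close>. The left-hand side has nonnegative integral, because \<open>T\<close>
  preserves the measure and \<open>m\<close> increases; so if these points had full measure, dominated convergence
  would give \<open>\<integral> f \<ge> 0\<close>. Ergodicity leaves only the alternative that they form a null set.
\<close>

lemma AE_birkhoff_sums_bounded_above:
  fixes f :: "'a \<Rightarrow> real"
  assumes f: "integrable M f" and neg: "(\<integral>x. f x \<partial>M) < 0"
  shows "AE x in M. \<exists>B. \<forall>n. (\<Sum>i<n. f ((T ^^ i) x)) \<le> B"
proof -
  have [measurable]: "f \<in> borel_measurable M" using f by simp
  have [measurable]: "\<And>i. (T ^^ i) \<in> measurable M M" by (rule measurable_funpow[OF T_meas])
  define S where "S n x = (\<Sum>i<n. f ((T ^^ i) x))" for n x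
  have [measurable]: "S n \<in> borel_measurable M" for n unfolding S_def by measurable
  have S_Suc: "S (Suc n) x = f x + S n (T x)" for n x
    unfolding S_def by (rule birkhoff_sum_Suc)
  \<comment> \<open>defined by the recursion \<open>max {S 1, \<dots>, S (n + 2)} = f + max 0 (max {S 1, \<dots>, S (n + 1)} \<circ> T)\<close>\<close>
  define m where "m = rec_nat f (\<lambda>_ g x. f x + max 0 (g (T x)))"
  have m0: "m 0 x = f x" and mS: "m (Suc n) x = f x + max 0 (m n (T x))" for n x
    by (simp_all add: m_def)
  have m_int: "integrable M (m n)" for n
  proof (induction n)
    case 0 then show ?case using f by (simp add: m0[abs_def])
  next
    case (Suc n)
    then have "integrable M (\<lambda>x. m n (T x))" by (rule integrable_comp_invariant)
    then have "integrable M (\<lambda>x. f x + max 0 (m n (T x)))"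
      using f by auto
    then show ?case by (simp add: mS[abs_def])
  qed
  have [measurable]: "m n \<in> borel_measurable M" for n using m_int by auto
  have m_mono: "m n x \<le> m (Suc n) x" for n x
  proof (induction n arbitrary: x)
    case (Suc n) show ?case using Suc[of "T x"] mS[of n x] mS[of "Suc n" x] by linarith
  qed (simp add: m0 mS)
  have m_mono': "i \<le> j \<Longrightarrow> m i x \<le> m j x" for i j x
    by (rule lift_Suc_mono_le[of "\<lambda>n. m n x"]) (auto intro: m_mono)
  have S_le_m: "S (Suc n) x \<le> m n x" for n x
  proof (induction n arbitrary: x)
    case 0 show ?case by (simp add: S_Suc m0) (simp add: S_def)
  next
    case (Suc n) then show ?case
      by (subst S_Suc) (auto simp: mS intro: le_max_iff_disj[THEN iffD2])
  qed
  have m_le_S: "\<exists>k. m n x = S (Suc k) x" for n x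
  proof (induction n arbitrary: x)
    case 0 show ?case by (rule exI[of _ 0]) (simp add: S_Suc m0, simp add: S_def)
  next
    case (Suc n)
    then obtain k where k: "m n (T x) = S (Suc k) (T x)" by blast
    show ?case
    proof (cases "m n (T x) \<ge> 0")
      case True then show ?thesis by (intro exI[of _ "Suc k"]) (subst S_Suc, simp add: mS k)
    next
      case False then show ?thesis by (intro exI[of _ 0]) (simp add: S_Suc mS, simp add: S_def)
    qed
  qed
  define A where "A = {x \<in> space M. \<forall>B::nat. \<exists>n. S n x > real B}"
  have A_meas [measurable]: "A \<in> sets M" unfolding A_def by measurable
  have A_iff: "x \<in> A \<longleftrightarrow> x \<in> space M \<and> (\<forall>B::real. \<exists>n. S n x > B)" for x
    unfolding A_def by (auto) (meson le_less_trans real_arch_simple)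
  have "T x \<in> A \<longleftrightarrow> x \<in> A" if x: "x \<in> space M" for x
  proof -
    have Tx: "T x \<in> space M" using x T_meas by (rule measurable_space[rotated])
    have "(\<forall>B. \<exists>n. S n (T x) > B) \<longleftrightarrow> (\<forall>B. \<exists>n. S n x > B)"
    proof safe
      fix B assume "\<forall>B. \<exists>n. S n (T x) > B"
      then obtain n where "S n (T x) > B - f x" by blast
      then show "\<exists>n. S n x > B" by (intro exI[of _ "Suc n"]) (simp add: S_Suc)
    next
      fix B assume a: "\<forall>B. \<exists>n. S n x > B"
      obtain n where n: "S n x > max 0 (B + f x)" using a by blast
      then have "n \<noteq> 0" by (intro notI) (simp add: S_def)
      then obtain k where "n = Suc k" by (cases n) auto
      then show "\<exists>n. S n (T x) > B" using n by (intro exI[of _ k]) (simp add: S_Suc)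
    qed
    then show ?thesis using x Tx by (simp add: A_iff)
  qed
  then have "T -` A \<inter> space M = A" by (auto simp: A_iff)
  then have alt: "emeasure M A = 0 \<or> emeasure M (space M - A) = 0" by (rule erg[OF A_meas])
  have "\<not> emeasure M (space M - A) = 0"
  proof
    assume "emeasure M (space M - A) = 0"
    then have AE_A: "AE x in M. x \<in> A"
      by (intro AE_I[of _ _ "space M - A"]) auto
    have lim: "(\<lambda>n. m (Suc n) x - m n (T x)) \<longlonglongrightarrow> f x" if "x \<in> A" for x
    proof -
      have "x \<in> space M" using that by (simp add: A_iff)
      then have "T x \<in> A" using that \<open>T -` A \<inter> space M = A\<close> by auto
      then obtain n where n: "S n (T x) > 0" by (auto simp: A_iff)
      then have "n \<noteq> 0" by (intro notI) (simp add: S_def)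
      then obtain k where "n = Suc k" by (cases n) auto
      then have k: "m k (T x) > 0" using n S_le_m[of k "T x"] by simp
      have "m (Suc j) x - m j (T x) = f x" if "j \<ge> k" for j
        using m_mono'[OF that, of "T x"] k by (simp add: mS)
      then have "eventually (\<lambda>j. m (Suc j) x - m j (T x) = f x) sequentially"
        by (auto simp: eventually_sequentially)
      then show ?thesis by (rule tendsto_eventually)
    qed
    have "(\<lambda>n. \<integral>x. m (Suc n) x - m n (T x) \<partial>M) \<longlonglongrightarrow> (\<integral>x. f x \<partial>M)"
    proof (rule integral_dominated_convergence[where w="\<lambda>x. \<bar>f x\<bar> + \<bar>m 0 (T x)\<bar>"])
      show "integrable M (\<lambda>x. \<bar>f x\<bar> + \<bar>m 0 (T x)\<bar>)"
        using f integrable_comp_invariant(1)[OF m_int[of 0]] by auto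
      show "AE x in M. (\<lambda>n. m (Suc n) x - m n (T x)) \<longlonglongrightarrow> f x" using AE_A lim by auto
      have "norm (m (Suc n) x - m n (T x)) \<le> \<bar>f x\<bar> + \<bar>m 0 (T x)\<bar>" for n x
        using m_mono'[of 0 n "T x"] by (auto simp: mS)
      then show "AE x in M. norm (m (Suc n) x - m n (T x)) \<le> \<bar>f x\<bar> + \<bar>m 0 (T x)\<bar>" for n
        by auto
    qed measurable
    moreover have "(\<integral>x. m (Suc n) x - m n (T x) \<partial>M) \<ge> 0" for n
    proof -
      have "(\<integral>x. m (Suc n) x - m n (T x) \<partial>M) = (\<integral>x. m (Suc n) x \<partial>M) - (\<integral>x. m n x \<partial>M)"
        using integrable_comp_invariant[OF m_int[of n]] m_int by simp
      moreover have "(\<integral>x. m n x \<partial>M) \<le> (\<integral>x. m (Suc n) x \<partial>M)"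
        by (intro integral_mono m_int m_mono)
      ultimately show ?thesis by simp
    qed
    ultimately have "(\<integral>x. f x \<partial>M) \<ge> 0"
      by (intro LIMSEQ_le_const) auto
    then show False using neg by simp
  qed
  then have "emeasure M A = 0" using alt by simp
  then have "AE x in M. x \<notin> A" by (intro AE_I[of _ _ A]) auto
  then show ?thesis
    by (rule AE_mp) (auto intro!: AE_I2 simp: A_iff S_def not_less)
qed

lemma AE_birkhoff_averages_eventually_less:
  fixes f :: "'a \<Rightarrow> real"
  assumes f: "integrable M f" and c: "(\<integral>x. f x \<partial>M) < c * measure M (space M)"
  shows "AE x in M. \<forall>e>0. eventually (\<lambda>n. (\<Sum>i<n. f ((T ^^ i) x)) / n < c + e) sequentially"
proof -
  interpret finite_measure M by (rule finM)
  have "integrable M (\<lambda>x. f x - c)" using f by simp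
  moreover have "(\<integral>x. f x - c \<partial>M) < 0" using f c by (simp add: mult.commute)
  ultimately have "AE x in M. \<exists>B. \<forall>n. (\<Sum>i<n. f ((T ^^ i) x) - c) \<le> B"
    by (rule AE_birkhoff_sums_bounded_above)
  then show ?thesis
  proof (rule AE_mp, intro AE_I2 impI allI)
    fix x and e :: real
    assume "\<exists>B. \<forall>n. (\<Sum>i<n. f ((T ^^ i) x) - c) \<le> B" and e: "0 < e"
    then obtain B where B: "\<And>n. (\<Sum>i<n. f ((T ^^ i) x)) - n * c \<le> B"
      by (auto simp: sum_subtractf)
    obtain N where N: "real N > B / e" using reals_Archimedean2 by blast
    show "eventually (\<lambda>n. (\<Sum>i<n. f ((T ^^ i) x)) / n < c + e) sequentially"
      unfolding eventually_sequentially
    proof (intro exI[of _ "Suc N"] allI impI)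
      fix n assume n: "Suc N \<le> n"
      then have "B < n * e" using N e by (simp add: field_simps) (smt (verit) mult_left_mono of_nat_Suc of_nat_mono)
      then have "(\<Sum>i<n. f ((T ^^ i) x)) < n * (c + e)" using B[of n] by (simp add: algebra_simps)
      then show "(\<Sum>i<n. f ((T ^^ i) x)) / n < c + e" using n by (simp add: field_simps)
    qed
  qed
qed

text \<open>
  The bound on sums of negative mean, applied to \<open>f - c\<close> and to \<open>c' - f\<close> for constants \<open>c\<close> slightly
  above and \<open>c'\<close> slightly below the mean of \<open>f\<close>, squeezes the averages.
\<close>

theorem birkhoff_ergodic:
  fixes f :: "'a \<Rightarrow> real"
  assumes f: "integrable M f" and pos: "measure M (space M) > 0"
  shows "AE x in M. (\<lambda>n. (\<Sum>i<n. f ((T ^^ i) x)) / n) \<longlonglongrightarrow> (\<integral>x. f x \<partial>M) / measure M (space M)"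
proof -
  define c where "c = (\<integral>x. f x \<partial>M) / measure M (space M)"
  have one: "AE x in M. \<forall>k::nat. \<forall>e>0. eventually (\<lambda>n. (\<Sum>i<n. g ((T ^^ i) x)) / n < a + 1 / Suc k + e) sequentially"
    if g: "integrable M g" and a: "(\<integral>x. g x \<partial>M) = a * measure M (space M)" for g :: "'a \<Rightarrow> real" and a
    unfolding AE_all_countable
    by (intro allI AE_birkhoff_averages_eventually_less g) (use pos a in \<open>simp add: field_simps\<close>)
  have "AE x in M. \<forall>k::nat. \<forall>e>0. eventually (\<lambda>n. (\<Sum>i<n. f ((T ^^ i) x)) / n < c + 1 / Suc k + e) sequentially"
    using f pos by (intro one) (auto simp: c_def)
  moreover have "AE x in M. \<forall>k::nat. \<forall>e>0. eventually (\<lambda>n. (\<Sum>i<n. - f ((T ^^ i) x)) / n < - c + 1 / Suc k + e) sequentially"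
    using f pos by (intro one) (auto simp: c_def)
  ultimately show ?thesis unfolding c_def[symmetric]
  proof eventually_elim
    case (elim x)
    show ?case
    proof (rule tendstoI)
      fix e :: real assume e: "0 < e"
      obtain k :: nat where k: "1 / Suc k < e / 2" using e by (meson half_gt_zero nat_approx_posE)
      have "eventually (\<lambda>n. (\<Sum>i<n. f ((T ^^ i) x)) / n < c + 1 / Suc k + e / 2) sequentially"
        using elim(1) e by auto
      moreover have "eventually (\<lambda>n. (\<Sum>i<n. - f ((T ^^ i) x)) / n < - c + 1 / Suc k + e / 2) sequentially"
        using elim(2) e by auto
      ultimately show "eventually (\<lambda>n. dist ((\<Sum>i<n. f ((T ^^ i) x)) / n) c < e) sequentially"
      proof eventually_elim
        case (elim n)
        then show ?case using k by (auto simp: sum_negf dist_real_def)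
      qed
    qed
  qed
qed

end

section \<open>Integration over the unit square\<close>

abbreviation unit_lborel :: "real measure" where
  "unit_lborel \<equiv> density lborel (indicator {0..1})"

definition square_lborel :: "(real \<times> real) measure" where
  "square_lborel = density lborel (indicator ({0..1} \<times> {0..1}))"

lemma sets_square_lborel [simp, measurable_cong]: "sets square_lborel = sets borel"
  by (simp add: square_lborel_def)

lemma space_square_lborel [simp]: "space square_lborel = UNIV"
  by (simp add: square_lborel_def)

lemma nn_integral_unit_lborel:
  assumes [measurable]: "f \<in> borel_measurable borel"
  shows "(\<integral>\<^sup>+x. f x \<partial>unit_lborel) = (\<integral>\<^sup>+x. f x * indicator {0..1} x \<partial>lborel)"
  by (subst nn_integral_density) (auto simp: mult.commute)

lemma emeasure_unit_lborel_UNIV: "emeasure unit_lborel UNIV = 1"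
  by (simp add: emeasure_density)

text \<open>
  Registers the measurability of inner integrals, so that iterated integrals need no separate proof.
\<close>

lemma borel_measurable_nn_integral_unit_lborel [measurable (raw)]:
  assumes "case_prod f \<in> borel_measurable (N \<Otimes>\<^sub>M borel)"
  shows "(\<lambda>x. \<integral>\<^sup>+y. f x y \<partial>unit_lborel) \<in> borel_measurable N"
proof -
  interpret finite_measure unit_lborel
    by (rule finite_measureI) (simp add: emeasure_unit_lborel_UNIV)
  have "sets (N \<Otimes>\<^sub>M unit_lborel) = sets (N \<Otimes>\<^sub>M borel)" by (intro sets_pair_measure_cong) auto
  then show ?thesis
    using assms by (intro borel_measurable_nn_integral) (simp cong: measurable_cong_sets)
qed

lemma nn_integral_square_lborel:
  assumes [measurable]: "f \<in> borel_measurable borel"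
  shows "(\<integral>\<^sup>+p. f p \<partial>square_lborel) = (\<integral>\<^sup>+x. (\<integral>\<^sup>+y. f (x, y) \<partial>unit_lborel) \<partial>unit_lborel)"
proof -
  have [measurable]: "{0..1::real} \<times> {0..1::real} \<in> sets borel" by (intro borel_closed closed_Times) auto
  have ind [measurable]: "(\<lambda>p. indicator ({0..1} \<times> {0..1}) p * f p) \<in> borel_measurable (lborel \<Otimes>\<^sub>M lborel)"
    by (subst lborel_prod) measurable
  have f2 [measurable]: "f \<in> borel_measurable (borel \<Otimes>\<^sub>M borel)" by (simp add: borel_prod)
  have "(\<integral>\<^sup>+p. f p \<partial>square_lborel) = (\<integral>\<^sup>+p. indicator ({0..1} \<times> {0..1}) p * f p \<partial>(lborel \<Otimes>\<^sub>M lborel))"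
    unfolding square_lborel_def lborel_prod by (subst nn_integral_density) auto
  also have "\<dots> = (\<integral>\<^sup>+x. (\<integral>\<^sup>+y. indicator ({0..1} \<times> {0..1}) (x, y) * f (x, y) \<partial>lborel) \<partial>lborel)"
    by (subst lborel.nn_integral_fst[symmetric]) auto
  also have "\<dots> = (\<integral>\<^sup>+x. (\<integral>\<^sup>+y. f (x, y) \<partial>unit_lborel) * indicator {0..1} x \<partial>lborel)"
    by (intro nn_integral_cong, subst nn_integral_unit_lborel)
       (auto simp: indicator_times indicator_def mult.commute)
  also have "\<dots> = (\<integral>\<^sup>+x. (\<integral>\<^sup>+y. f (x, y) \<partial>unit_lborel) \<partial>unit_lborel)"
    by (rule nn_integral_unit_lborel[symmetric]) measurable
  finally show ?thesis .
qed

lemma emeasure_square_lborel_UNIV: "emeasure square_lborel UNIV = 1"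
proof -
  have "emeasure square_lborel UNIV = (\<integral>\<^sup>+p. 1 \<partial>square_lborel)" by simp
  also have "\<dots> = 1" by (subst nn_integral_square_lborel) (auto simp: emeasure_unit_lborel_UNIV)
  finally show ?thesis .
qed

lemma AE_unit_lborel_irrational: "AE x in unit_lborel. 0 < x \<and> x < 1 \<and> x \<notin> \<rat>"
proof -
  have "AE x in lborel. (x::real) \<notin> \<rat>"
    by (intro AE_not_in countable_imp_null_set_lborel countable_rat)
  then have "AE x::real in lborel. x \<in> {0..1} \<longrightarrow> 0 < x \<and> x < 1 \<and> x \<notin> \<rat>"
    by (rule eventually_mono) (auto simp: less_le)
  then show ?thesis by (subst AE_density) auto
qed

lemma AE_square_lborel_fst_notin_countable:
  assumes "countable C"
  shows "AE p in square_lborel. fst p \<notin> C"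
proof -
  let ?R = "C \<times> UNIV :: (real \<times> real) set"
  have "C \<in> sets borel" by (rule sets.countable) (auto simp: assms)
  then have R: "?R \<in> sets borel"
    by (subst borel_prod[symmetric]) (rule pair_measureI; simp)
  have AE_C: "AE x in unit_lborel. x \<notin> C"
    using AE_not_in[OF countable_imp_null_set_lborel[OF assms]] \<open>C \<in> sets borel\<close>
    by (subst AE_density) (auto elim: eventually_mono)
  have "emeasure square_lborel ?R = (\<integral>\<^sup>+x. (\<integral>\<^sup>+y. indicator ?R (x, y) \<partial>unit_lborel) \<partial>unit_lborel)"
    using nn_integral_square_lborel[of "indicator ?R"] R by simp
  also have "\<dots> = (\<integral>\<^sup>+x. 0 \<partial>unit_lborel)"
    by (intro nn_integral_cong_AE, use AE_C in eventually_elim) (simp add: indicator_def)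
  finally have "AE p in square_lborel. p \<notin> ?R"
    using R by (intro AE_not_in) (simp add: null_sets_def)
  then show ?thesis by eventually_elim (simp add: mem_Times_iff)
qed

lemma AE_square_lborel: "AE p in square_lborel. 0 < fst p \<and> fst p < 1 \<and> fst p \<notin> \<rat> \<and> 0 \<le> snd p \<and> snd p \<le> 1"
proof -
  have "AE p in square_lborel. fst p \<notin> \<rat>" by (rule AE_square_lborel_fst_notin_countable[OF countable_rat])
  moreover have "AE p in square_lborel. p \<in> {0..1} \<times> {0..1}"
  proof -
    have "{0..1::real} \<times> {0..1::real} \<in> sets borel" by (intro borel_closed closed_Times) auto
    then show ?thesis unfolding square_lborel_def
      by (subst AE_density) (simp, intro AE_I2, simp add: indicator_def)
  qed
  ultimately show ?thesis
  proof eventually_elim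
    case (elim p)
    then have "fst p \<noteq> 0" "fst p \<noteq> 1" by auto
    then show ?case using elim by (simp add: mem_Times_iff less_le)
  qed
qed

lemma nn_integral_lborel_Icc_affine:
  assumes [measurable]: "f \<in> borel_measurable borel" and ab: "a < b"
  shows "(\<integral>\<^sup>+x. f x * indicator {a..b} x \<partial>lborel) = ennreal (b - a) * (\<integral>\<^sup>+v. f (a + (b - a) * v) \<partial>unit_lborel)"
proof -
  have [measurable]: "f \<in> borel_measurable lborel" by simp
  have "indicator {a..b} (a + (b - a) * v) = (indicator {0..1} v :: ennreal)" for v
  proof -
    have "a + (b - a) * v \<le> b \<longleftrightarrow> (b - a) * v \<le> (b - a) * 1" by (simp add: algebra_simps)
    also have "\<dots> \<longleftrightarrow> v \<le> 1" using ab by (intro mult_le_cancel_left_pos) simp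
    finally show ?thesis using ab zero_le_mult_iff[of "b - a" v] by (auto simp: indicator_def)
  qed
  then show ?thesis
    using ab by (subst nn_integral_real_affine[of _ "b - a" a]) (auto simp: nn_integral_unit_lborel)
qed

lemma nn_integral_unit_lborel_reflect:
  assumes [measurable]: "f \<in> borel_measurable borel"
  shows "(\<integral>\<^sup>+v. f (1 - v) \<partial>unit_lborel) = (\<integral>\<^sup>+v. f v \<partial>unit_lborel)"
proof -
  have "indicator {0..1} (1 - v) = (indicator {0..1} (v::real) :: ennreal)" for v
    by (auto simp: indicator_def)
  then show ?thesis
    by (simp add: nn_integral_unit_lborel) (subst (2) nn_integral_real_affine[of _ "-1" 1], auto)
qed

lemma nn_integral_lborel_Icc_split:
  assumes [measurable]: "f \<in> borel_measurable borel" and "a \<le> b" "b \<le> (c::real)"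
  shows "(\<integral>\<^sup>+x. f x * indicator {a..c} x \<partial>lborel) = (\<integral>\<^sup>+x. f x * indicator {a..b} x \<partial>lborel) + (\<integral>\<^sup>+x. f x * indicator {b..c} x \<partial>lborel)"
proof -
  have "(\<integral>\<^sup>+x. f x * indicator {a..c} x \<partial>lborel) = (\<integral>\<^sup>+x. f x * indicator {a..b} x + f x * indicator {b..c} x \<partial>lborel)"
    using assms AE_lborel_singleton[of b]
    by (intro nn_integral_cong_AE, elim AE_mp, intro AE_I2) (auto simp: indicator_def)
  then show ?thesis by (simp add: nn_integral_add)
qed

text \<open>
  For \<open>m = \<lfloor>1 / x\<rfloor>\<close> these are the pieces of the fibre over \<open>x\<close> on which the accelerated map is affine; up
  to endpoints it maps each of them onto a whole fibre. The strips are numbered from the top and traversed downwards because a green step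
  reverses the orientation of the fibre.
\<close>

lemma nn_integral_unit_lborel_strips:
  assumes f [measurable]: "f \<in> borel_measurable borel" and x: "0 < x" and m: "real m * x < 1"
  shows "(\<integral>\<^sup>+y. f y \<partial>unit_lborel) =
    (\<Sum>n<m. ennreal x * (\<integral>\<^sup>+v. f (1 - (real n + v) * x) \<partial>unit_lborel)) +
    ennreal (1 - real m * x) * (\<integral>\<^sup>+v. f ((1 - real m * x) * v) \<partial>unit_lborel)"
proof -
  have strip: "(\<integral>\<^sup>+y. f y * indicator {1 - real (Suc n) * x .. 1 - real n * x} y \<partial>lborel)
      = ennreal x * (\<integral>\<^sup>+v. f (1 - (real n + v) * x) \<partial>unit_lborel)" for n
  proof -
    have "1 - real (Suc n) * x < 1 - real n * x" using x by (simp add: algebra_simps)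
    from nn_integral_lborel_Icc_affine[OF f this]
    have "(\<integral>\<^sup>+y. f y * indicator {1 - real (Suc n) * x .. 1 - real n * x} y \<partial>lborel)
      = ennreal x * (\<integral>\<^sup>+v. f (1 - (real n + (1 - v)) * x) \<partial>unit_lborel)"
      by (simp add: algebra_simps)
    then show ?thesis by (subst (asm) nn_integral_unit_lborel_reflect[of "\<lambda>v. f (1 - (real n + v) * x)"]) auto
  qed
  have "(\<integral>\<^sup>+y. f y \<partial>unit_lborel) = (\<Sum>n<m. ennreal x * (\<integral>\<^sup>+v. f (1 - (real n + v) * x) \<partial>unit_lborel)) +
    (\<integral>\<^sup>+y. f y * indicator {0 .. 1 - real m * x} y \<partial>lborel)"
    using m
  proof (induction m)
    case 0 then show ?case by (simp add: nn_integral_unit_lborel)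
  next
    case (Suc m)
    have "(\<integral>\<^sup>+y. f y * indicator {0 .. 1 - real m * x} y \<partial>lborel) =
      (\<integral>\<^sup>+y. f y * indicator {0 .. 1 - real (Suc m) * x} y \<partial>lborel) +
      (\<integral>\<^sup>+y. f y * indicator {1 - real (Suc m) * x .. 1 - real m * x} y \<partial>lborel)"
      using Suc.prems x by (intro nn_integral_lborel_Icc_split) (auto simp: algebra_simps)
    moreover have "real m * x < 1" using Suc.prems x by (simp add: algebra_simps)
    ultimately show ?case using Suc.IH unfolding sum.lessThan_Suc strip[symmetric]
      by (simp add: algebra_simps del: of_nat_Suc)
  qed
  then show ?thesis using m nn_integral_lborel_Icc_affine[OF f, of 0 "1 - real m * x"] by simp
qed

section \<open>Inverse branches of the Gauss map\<close>

text \<open>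
  Change of variables \<open>x = 1 / (m + 1 + t)\<close> on each of the intervals on which \<open>\<lfloor>1 / x\<rfloor> = m + 1\<close>.
\<close>

lemma nn_integral_unit_lborel_gauss_branches:
  assumes f [measurable]: "f \<in> borel_measurable borel"
  shows "(\<integral>\<^sup>+x. f x \<partial>unit_lborel) =
    (\<integral>\<^sup>+t. (\<Sum>m. ennreal (1 / (real (Suc m) + t)^2) * f (1 / (real (Suc m) + t))) \<partial>unit_lborel)"
proof -
  define J where "J m = {1 / real (Suc (Suc m)) <.. 1 / real (Suc m)}" for m
  have J_iff: "x \<in> J m \<longleftrightarrow> 0 < x \<and> \<lfloor>1 / x\<rfloor> = int (Suc m)" for x m
    unfolding J_def floor_eq_iff by (auto simp: field_simps)
  have ind: "(indicator {0<..1} x :: ennreal) = (\<Sum>m. indicator (J m) x)" for x :: real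
  proof -
    have "(\<Union>m. J m) = {0<..1}"
    proof safe
      fix x :: real assume x: "x \<in> {0<..1}"
      then have "1 \<le> \<lfloor>1 / x\<rfloor>" by simp
      then obtain m where "\<lfloor>1 / x\<rfloor> = int (Suc m)"
        by (metis zero_less_imp_eq_int gr0_conv_Suc zero_less_one order.strict_trans2)
      then show "x \<in> (\<Union>m. J m)" using x by (auto simp: J_iff)
    next
      fix x m assume "x \<in> J m"
      moreover have "1 / real (Suc m) \<le> 1" by simp
      moreover have "0 < 1 / real (Suc (Suc m))" by simp
      ultimately show "x \<in> {0<..1}" unfolding J_def greaterThanAtMost_iff by linarith
    qed
    moreover have "disjoint_family J" by (auto simp: disjoint_family_on_def J_iff)
    ultimately show ?thesis using suminf_indicator[of J x] by simp
  qed
  have "(\<integral>\<^sup>+x. f x \<partial>unit_lborel) = (\<integral>\<^sup>+x. f x * indicator {0<..1} x \<partial>lborel)"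
    using AE_lborel_singleton[of "0::real"] unfolding nn_integral_unit_lborel[OF f]
    by (intro nn_integral_cong_AE, elim AE_mp, intro AE_I2) (auto simp: indicator_def)
  also have "\<dots> = (\<integral>\<^sup>+x. (\<Sum>m. f x * indicator (J m) x) \<partial>lborel)"
    unfolding ind by (simp add: ennreal_suminf_cmult)
  also have "\<dots> = (\<Sum>m. \<integral>\<^sup>+x. f x * indicator (J m) x \<partial>lborel)"
    by (intro nn_integral_suminf) (auto simp: J_def)
  also have "\<dots> = (\<Sum>m. \<integral>\<^sup>+t. ennreal (1 / (real (Suc m) + t)^2) * f (1 / (real (Suc m) + t)) \<partial>unit_lborel)"
  proof (intro suminf_cong)
    fix m
    \<comment> \<open>the substitution rule wants an increasing function, so \<open>t = 1 - s\<close> is used first\<close>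
    let ?g = "\<lambda>s. 1 / (real (Suc (Suc m)) - s)" and ?g' = "\<lambda>s. 1 / (real (Suc (Suc m)) - s)^2"
    have "(\<integral>\<^sup>+x. f x * indicator (J m) x \<partial>lborel) = (\<integral>\<^sup>+x. f x * indicator {?g 0..?g 1} x \<partial>lborel)"
      using AE_lborel_singleton[of "?g 0"]
      by (intro nn_integral_cong_AE, elim AE_mp, intro AE_I2) (auto simp: indicator_def J_def)
    also have "\<dots> = (\<integral>\<^sup>+s. f (?g s) * ennreal (?g' s) * indicator {0..1} s \<partial>lborel)"
      by (intro nn_integral_substitution_aux)
         (auto intro!: derivative_eq_intros continuous_intros simp: power2_eq_square)
    also have "\<dots> = (\<integral>\<^sup>+s. ennreal (1 / (real (Suc m) + (1 - s))^2) * f (1 / (real (Suc m) + (1 - s))) \<partial>unit_lborel)"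
      by (subst nn_integral_unit_lborel) (auto simp: mult_ac add_diff_eq intro!: nn_integral_cong)
    also have "\<dots> = (\<integral>\<^sup>+t. ennreal (1 / (real (Suc m) + t)^2) * f (1 / (real (Suc m) + t)) \<partial>unit_lborel)"
      by (rule nn_integral_unit_lborel_reflect) measurable
    finally show "(\<integral>\<^sup>+x. f x * indicator (J m) x \<partial>lborel) = \<dots>" .
  qed
  also have "\<dots> = (\<integral>\<^sup>+t. (\<Sum>m. ennreal (1 / (real (Suc m) + t)^2) * f (1 / (real (Suc m) + t))) \<partial>unit_lborel)"
    by (intro nn_integral_suminf[symmetric]) measurable
  finally show ?thesis .
qed

section \<open>The accelerated map and its transfer operator\<close>

text \<open>
  A closed form of the fast map. Let \<open>m = \<lfloor>1 / x\<rfloor>\<close>. A run of red steps with partial quotient 1 moves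
  \<open>(x, y)\<close> to \<open>(x / (1 - n * x), y / (1 - n * x))\<close>. If \<open>1 - y \<le> m * x\<close> it is stopped by a green step,
  otherwise by a red step after \<open>n = m - 1\<close> steps. The \<open>nat\<close> and the ceiling make the formula correct also
  for \<open>y = 1\<close> and on the lines where \<open>(1 - y) / x\<close> is an integer, so that it agrees with the iterated
  slow map at every point of the square with irrational \<open>x\<close>.
\<close>

definition fast_map :: "real \<times> real \<Rightarrow> real \<times> real" where
  "fast_map = (\<lambda>(x, y). if 1 - y \<le> of_int \<lfloor>1 / x\<rfloor> * x
     then (gauss_map x, (1 - y) / x - real (nat (\<lceil>(1 - y) / x\<rceil> - 1)))
     else (gauss_map (gauss_map x), y / (x * gauss_map x)))"

text \<open>
  The Perron-Frobenius operator of \<open>fast_map\<close> for Lebesgue measure. The first sum belongs to the strips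
  \<open>n = 0, \<dots>, m\<close> over \<open>x = 1 / (m + 1 + t)\<close>, the second to the remaining points, where the
  continued fraction of \<open>x\<close> starts with \<open>m + 1\<close>, \<open>l + 1\<close>. Every inverse branch is projective: both
  coordinates have the same denominator \<open>D\<close>, fibres are contracted by \<open>1 / D\<close>, and the Jacobian is \<open>1 / D ^ 3\<close>.
  With values in the extended nonnegative reals no sum needs a proof of convergence.
\<close>

definition transfer :: "(real \<times> real \<Rightarrow> ennreal) \<Rightarrow> real \<times> real \<Rightarrow> ennreal" where
  "transfer g = (\<lambda>(t, v).
     (\<Sum>m. ennreal (1 / (real (Suc m) + t) ^ 3) *
        (\<Sum>n<Suc m. g (1 / (real (Suc m) + t), 1 - (real n + v) / (real (Suc m) + t)))) +
     (\<Sum>l. \<Sum>m. ennreal (1 / (1 + real (Suc m) * (real (Suc l) + t)) ^ 3) *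
        g ((real (Suc l) + t) / (1 + real (Suc m) * (real (Suc l) + t)),
           v / (1 + real (Suc m) * (real (Suc l) + t)))))"

lemma borel_measurable_gauss_map [measurable]: "gauss_map \<in> borel_measurable borel"
  unfolding gauss_map_def[abs_def] by measurable

lemma borel_measurable_fast_map [measurable]: "fast_map \<in> borel_measurable borel"
proof -
  have "fast_map \<in> borel \<Otimes>\<^sub>M borel \<rightarrow>\<^sub>M borel \<Otimes>\<^sub>M borel"
    unfolding fast_map_def case_prod_unfold by measurable
  then show ?thesis by (simp add: borel_prod)
qed

lemma borel_measurable_transfer [measurable]:
  assumes "g \<in> borel_measurable borel"
  shows "transfer g \<in> borel_measurable borel"
proof -
  have [measurable]: "g \<in> borel_measurable (borel \<Otimes>\<^sub>M borel)" using assms by (simp add: borel_prod)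
  have "transfer g \<in> borel_measurable (borel \<Otimes>\<^sub>M borel)"
    unfolding transfer_def case_prod_unfold by measurable
  then show ?thesis by (simp add: borel_prod)
qed

lemma gauss_map_inverse_branch:
  assumes "0 \<le> t" "t < 1"
  shows "\<lfloor>1 / (1 / (real (Suc m) + t))\<rfloor> = int (Suc m)" "gauss_map (1 / (real (Suc m) + t)) = t"
proof -
  show "\<lfloor>1 / (1 / (real (Suc m) + t))\<rfloor> = int (Suc m)" using assms by (simp add: floor_eq_iff)
  then show "gauss_map (1 / (real (Suc m) + t)) = t" by (simp add: gauss_map_def)
qed

lemma gauss_map_irrational:
  assumes "0 < x" "x < 1" "x \<notin> \<rat>"
  shows "0 < gauss_map x" "gauss_map x < 1" "gauss_map x \<notin> \<rat>"
    "\<lfloor>1 / x\<rfloor> \<ge> 1" "x * gauss_map x = 1 - of_int \<lfloor>1 / x\<rfloor> * x"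
proof -
  have irr: "1 / x \<notin> \<rat>" using assms(3) Rats_inverse[of "1 / x"] by (auto simp: field_simps)
  show "gauss_map x \<notin> \<rat>"
  proof
    assume "gauss_map x \<in> \<rat>"
    then have "gauss_map x + of_int \<lfloor>1 / x\<rfloor> \<in> \<rat>" by (intro Rats_add) auto
    then show False using irr by (simp add: gauss_map_def)
  qed
  then have "gauss_map x \<noteq> 0" by auto
  then show "0 < gauss_map x" "gauss_map x < 1" unfolding gauss_map_def by linarith+
  show "\<lfloor>1 / x\<rfloor> \<ge> 1" using assms by simp
  show "x * gauss_map x = 1 - of_int \<lfloor>1 / x\<rfloor> * x"
    using assms by (simp add: gauss_map_def field_simps)
qed

lemma fast_map_upper:
  assumes "0 < x" "n < nat \<lfloor>1 / x\<rfloor>" "0 < v" "v \<le> 1"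
  shows "fast_map (x, 1 - (real n + v) * x) = (gauss_map x, v)"
proof -
  have "real n + v \<le> of_int \<lfloor>1 / x\<rfloor>" using assms by linarith
  then have "(real n + v) * x \<le> of_int \<lfloor>1 / x\<rfloor> * x" using assms by (intro mult_right_mono) auto
  moreover have "\<lceil>real n + v\<rceil> = int n + 1" using assms by (simp add: ceiling_eq_iff)
  ultimately show ?thesis using assms by (simp add: fast_map_def)
qed

lemma fast_map_lower:
  assumes "0 < x" "x < 1" "x \<notin> \<rat>" "v < 1"
  shows "fast_map (x, x * gauss_map x * v) = (gauss_map (gauss_map x), v)"
proof -
  note g = gauss_map_irrational[OF assms(1-3)]
  have "x * gauss_map x * v < x * gauss_map x * 1" using assms mult_pos_pos[OF assms(1) g(1)] by (intro mult_strict_left_mono) auto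
  then have "\<not> 1 - x * gauss_map x * v \<le> of_int \<lfloor>1 / x\<rfloor> * x" using g(5) by simp
  then show ?thesis using assms g(1) by (simp add: fast_map_def)
qed

text \<open>
  The fibres are cut into strips, and the Gauss map is inverted once above the strips and twice
  over the remaining points.
\<close>

theorem nn_integral_fast_map_transfer:
  assumes u [measurable]: "u \<in> borel_measurable borel" and g [measurable]: "g \<in> borel_measurable borel"
  shows "(\<integral>\<^sup>+p. u (fast_map p) * g p \<partial>square_lborel) = (\<integral>\<^sup>+p. u p * transfer g p \<partial>square_lborel)"
proof -
  have [measurable]: "u \<in> borel_measurable (borel \<Otimes>\<^sub>M borel)" "g \<in> borel_measurable (borel \<Otimes>\<^sub>M borel)"
    by (simp_all add: borel_prod)
  have [measurable]: "fast_map \<in> borel \<Otimes>\<^sub>M borel \<rightarrow>\<^sub>M borel \<Otimes>\<^sub>M borel" by (simp add: borel_prod)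
  define H1 where "H1 x = (\<Sum>n. if real (Suc n) * x \<le> 1 then
      ennreal x * (\<integral>\<^sup>+v. u (gauss_map x, v) * g (x, 1 - (real n + v) * x) \<partial>unit_lborel) else 0)" for x
  define H2 where "H2 x = ennreal (x * gauss_map x) *
      (\<integral>\<^sup>+v. u (gauss_map (gauss_map x), v) * g (x, x * gauss_map x * v) \<partial>unit_lborel)" for x
  have [measurable]: "H1 \<in> borel_measurable borel" "H2 \<in> borel_measurable borel"
    unfolding H1_def[abs_def] H2_def[abs_def] by measurable
  have H1_eq: "H1 x = (\<Sum>n<nat \<lfloor>1 / x\<rfloor>. ennreal x * (\<integral>\<^sup>+v. u (gauss_map x, v) * g (x, 1 - (real n + v) * x) \<partial>unit_lborel))"
    if "0 < x" for x
  proof -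
    have iff: "real (Suc n) * x \<le> 1 \<longleftrightarrow> n < nat \<lfloor>1 / x\<rfloor>" for n
    proof -
      have "real (Suc n) * x \<le> 1 \<longleftrightarrow> of_int (int (Suc n)) \<le> 1 / x" using that by (simp add: field_simps)
      also have "\<dots> \<longleftrightarrow> int (Suc n) \<le> \<lfloor>1 / x\<rfloor>" by (rule le_floor_iff[symmetric])
      finally show ?thesis by linarith
    qed
    show ?thesis unfolding H1_def iff by (subst suminf_finite[of "{..<nat \<lfloor>1 / x\<rfloor>}"]) auto
  qed
  have AE_v: "AE v in unit_lborel. 0 < v \<and> v < 1" using AE_unit_lborel_irrational by eventually_elim auto
  have inner: "(\<integral>\<^sup>+y. u (fast_map (x, y)) * g (x, y) \<partial>unit_lborel) = H1 x + H2 x"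
    if x: "0 < x" "x < 1" "x \<notin> \<rat>" for x
  proof -
    note gm = gauss_map_irrational[OF x]
    define m where "m = nat \<lfloor>1 / x\<rfloor>"
    have m: "real m = of_int \<lfloor>1 / x\<rfloor>" using gm(4) unfolding m_def by linarith
    have rest: "1 - real m * x = x * gauss_map x" using gm m by simp
    have "real m * x < 1" using rest mult_pos_pos[OF x(1) gm(1)] by linarith
    then have "(\<integral>\<^sup>+y. u (fast_map (x, y)) * g (x, y) \<partial>unit_lborel) =
      (\<Sum>n<m. ennreal x * (\<integral>\<^sup>+v. u (fast_map (x, 1 - (real n + v) * x)) * g (x, 1 - (real n + v) * x) \<partial>unit_lborel)) +
      ennreal (x * gauss_map x) * (\<integral>\<^sup>+v. u (fast_map (x, x * gauss_map x * v)) * g (x, x * gauss_map x * v) \<partial>unit_lborel)"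
      using x by (subst nn_integral_unit_lborel_strips[of _ x m]) (simp_all add: rest)
    also have "\<dots> = H1 x + H2 x"
      unfolding H1_eq[OF x(1)] H2_def m_def[symmetric]
    proof (intro arg_cong2[where f="(+)"] sum.cong refl arg_cong2[where f="(*)"] nn_integral_cong_AE)
      fix n assume "n \<in> {..<m}"
      then have n: "n < nat \<lfloor>1 / x\<rfloor>" by (simp add: m_def)
      show "AE v in unit_lborel. u (fast_map (x, 1 - (real n + v) * x)) * g (x, 1 - (real n + v) * x)
          = u (gauss_map x, v) * g (x, 1 - (real n + v) * x)"
        using AE_v by eventually_elim (simp add: fast_map_upper[OF x(1) n])
    next
      show "AE v in unit_lborel. u (fast_map (x, x * gauss_map x * v)) * g (x, x * gauss_map x * v) =
             u (gauss_map (gauss_map x), v) * g (x, x * gauss_map x * v)"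
        using AE_v by eventually_elim (simp add: fast_map_lower x)
    qed
    finally show ?thesis .
  qed
  have "(\<integral>\<^sup>+p. u (fast_map p) * g p \<partial>square_lborel) =
      (\<integral>\<^sup>+x. (\<integral>\<^sup>+y. u (fast_map (x, y)) * g (x, y) \<partial>unit_lborel) \<partial>unit_lborel)"
    by (rule nn_integral_square_lborel) measurable
  also have "\<dots> = (\<integral>\<^sup>+x. H1 x + H2 x \<partial>unit_lborel)"
    by (intro nn_integral_cong_AE, use AE_unit_lborel_irrational in eventually_elim) (simp add: inner)
  also have "\<dots> = (\<integral>\<^sup>+x. H1 x \<partial>unit_lborel) + (\<integral>\<^sup>+x. H2 x \<partial>unit_lborel)"
    by (rule nn_integral_add) auto
  finally have LHS: "(\<integral>\<^sup>+p. u (fast_map p) * g p \<partial>square_lborel) = \<dots>" .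

  define A where "A t v = (\<Sum>m. ennreal (1 / (real (Suc m) + t) ^ 3) *
        (\<Sum>n<Suc m. g (1 / (real (Suc m) + t), 1 - (real n + v) / (real (Suc m) + t))))" for t v
  define B where "B t v = (\<Sum>l. \<Sum>m. ennreal (1 / (1 + real (Suc m) * (real (Suc l) + t)) ^ 3) *
        g ((real (Suc l) + t) / (1 + real (Suc m) * (real (Suc l) + t)),
           v / (1 + real (Suc m) * (real (Suc l) + t))))" for t v
  have [measurable]: "case_prod A \<in> borel_measurable (borel \<Otimes>\<^sub>M borel)" "case_prod B \<in> borel_measurable (borel \<Otimes>\<^sub>M borel)"
    unfolding A_def[abs_def] B_def[abs_def] case_prod_unfold by measurable
  have split: "u (t, v) * transfer g (t, v) = u (t, v) * A t v + u (t, v) * B t v" for t v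
    unfolding transfer_def A_def B_def prod.case by (rule distrib_left)
  have "(\<integral>\<^sup>+p. u p * transfer g p \<partial>square_lborel) =
      (\<integral>\<^sup>+t. (\<integral>\<^sup>+v. u (t, v) * transfer g (t, v) \<partial>unit_lborel) \<partial>unit_lborel)"
    by (rule nn_integral_square_lborel) measurable
  also have "\<dots> = (\<integral>\<^sup>+t. (\<integral>\<^sup>+v. u (t, v) * A t v \<partial>unit_lborel) + (\<integral>\<^sup>+v. u (t, v) * B t v \<partial>unit_lborel) \<partial>unit_lborel)"
    unfolding split by (intro nn_integral_cong nn_integral_add) measurable
  also have "\<dots> = (\<integral>\<^sup>+t. (\<integral>\<^sup>+v. u (t, v) * A t v \<partial>unit_lborel) \<partial>unit_lborel) + (\<integral>\<^sup>+t. (\<integral>\<^sup>+v. u (t, v) * B t v \<partial>unit_lborel) \<partial>unit_lborel)"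
    by (rule nn_integral_add) measurable
  also have "(\<integral>\<^sup>+t. (\<integral>\<^sup>+v. u (t, v) * A t v \<partial>unit_lborel) \<partial>unit_lborel) = (\<integral>\<^sup>+x. H1 x \<partial>unit_lborel)"
  proof -
    have "(\<integral>\<^sup>+v. u (t, v) * A t v \<partial>unit_lborel) =
      (\<Sum>m. ennreal (1 / (real (Suc m) + t)^2) * H1 (1 / (real (Suc m) + t)))" if t: "0 < t" "t < 1" for t
    proof -
      have "(\<integral>\<^sup>+v. u (t, v) * A t v \<partial>unit_lborel) = (\<integral>\<^sup>+v. (\<Sum>m. \<Sum>n<Suc m. ennreal (1 / (real (Suc m) + t) ^ 3) *
         (u (t, v) * g (1 / (real (Suc m) + t), 1 - (real n + v) / (real (Suc m) + t)))) \<partial>unit_lborel)"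
        unfolding A_def ennreal_suminf_cmult[symmetric]
        by (simp only: sum_distrib_left mult.left_commute)
      also have "\<dots> = (\<Sum>m. \<Sum>n<Suc m. ennreal (1 / (real (Suc m) + t) ^ 3) *
         (\<integral>\<^sup>+v. u (t, v) * g (1 / (real (Suc m) + t), 1 - (real n + v) / (real (Suc m) + t)) \<partial>unit_lborel))"
        by (simp add: nn_integral_suminf nn_integral_sum nn_integral_cmult del: sum.lessThan_Suc of_nat_Suc)
      also have "\<dots> = (\<Sum>m. ennreal (1 / (real (Suc m) + t)^2) * H1 (1 / (real (Suc m) + t)))"
      proof (intro suminf_cong)
        fix m
        let ?w = "real (Suc m) + t"
        have w: "0 < ?w" and fl: "\<lfloor>t\<rfloor> = 0" using t by (simp_all add: floor_eq_iff)
        have "ennreal (1 / ?w ^ 3) = ennreal (1 / ?w ^ 2) * ennreal (1 / ?w)"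
          using w by (simp add: ennreal_mult[symmetric] power3_eq_cube power2_eq_square)
        then show "(\<Sum>n<Suc m. ennreal (1 / ?w ^ 3) * (\<integral>\<^sup>+v. u (t, v) * g (1 / ?w, 1 - (real n + v) / ?w) \<partial>unit_lborel))
          = ennreal (1 / ?w^2) * H1 (1 / ?w)"
          using w t by (subst H1_eq) (simp_all add: fl gauss_map_inverse_branch sum_distrib_left mult.assoc del: sum.lessThan_Suc of_nat_Suc)
      qed
      finally show ?thesis .
    qed
    then have "AE t in unit_lborel. (\<integral>\<^sup>+v. u (t, v) * A t v \<partial>unit_lborel) =
      (\<Sum>m. ennreal (1 / (real (Suc m) + t)^2) * H1 (1 / (real (Suc m) + t)))"
      using AE_v by auto
    then show ?thesis
      by (subst nn_integral_unit_lborel_gauss_branches) (auto intro: nn_integral_cong_AE)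
  qed
  also have "(\<integral>\<^sup>+t. (\<integral>\<^sup>+v. u (t, v) * B t v \<partial>unit_lborel) \<partial>unit_lborel) = (\<integral>\<^sup>+x. H2 x \<partial>unit_lborel)"
  proof -
    define K where "K s = (\<Sum>m. ennreal (s / (real (Suc m) + s)^3) *
      (\<integral>\<^sup>+v. u (gauss_map s, v) * g (1 / (real (Suc m) + s), s / (real (Suc m) + s) * v) \<partial>unit_lborel))" for s
    have [measurable]: "K \<in> borel_measurable borel" unfolding K_def[abs_def] by measurable
    have "(\<integral>\<^sup>+x. H2 x \<partial>unit_lborel) = (\<integral>\<^sup>+s. (\<Sum>m. ennreal (1 / (real (Suc m) + s)^2) * H2 (1 / (real (Suc m) + s))) \<partial>unit_lborel)"
      by (rule nn_integral_unit_lborel_gauss_branches) measurable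
    also have "\<dots> = (\<integral>\<^sup>+s. K s \<partial>unit_lborel)"
    proof (intro nn_integral_cong_AE, use AE_v in eventually_elim)
      case (elim s)
      show ?case unfolding K_def
      proof (intro suminf_cong)
        fix m
        let ?w = "real (Suc m) + s"
        have w: "0 < ?w" using elim by simp
        have "ennreal (s / ?w ^ 3) = ennreal (1 / ?w ^ 2) * ennreal (1 / ?w * s)"
          using w elim by (simp add: ennreal_mult[symmetric] power3_eq_cube power2_eq_square)
        then show "ennreal (1 / ?w^2) * H2 (1 / ?w) = ennreal (s / ?w^3) *
           (\<integral>\<^sup>+v. u (gauss_map s, v) * g (1 / ?w, s / ?w * v) \<partial>unit_lborel)"
          using w elim by (simp add: H2_def gauss_map_inverse_branch mult.assoc del: of_nat_Suc)
      qed
    qed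
    also have "\<dots> = (\<integral>\<^sup>+t. (\<Sum>l. ennreal (1 / (real (Suc l) + t)^2) * K (1 / (real (Suc l) + t))) \<partial>unit_lborel)"
      by (rule nn_integral_unit_lborel_gauss_branches) measurable
    also have "\<dots> = (\<integral>\<^sup>+t. (\<integral>\<^sup>+v. u (t, v) * B t v \<partial>unit_lborel) \<partial>unit_lborel)"
    proof (intro nn_integral_cong_AE, use AE_v in eventually_elim)
      case (elim t)
      have "(\<integral>\<^sup>+v. u (t, v) * B t v \<partial>unit_lborel) = (\<integral>\<^sup>+v. (\<Sum>l. \<Sum>m. ennreal (1 / (1 + real (Suc m) * (real (Suc l) + t)) ^ 3) *
          (u (t, v) * g ((real (Suc l) + t) / (1 + real (Suc m) * (real (Suc l) + t)), v / (1 + real (Suc m) * (real (Suc l) + t)))))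
          \<partial>unit_lborel)"
        unfolding B_def ennreal_suminf_cmult[symmetric] by (simp only: mult.left_commute)
      also have "\<dots> = (\<Sum>l. \<Sum>m. ennreal (1 / (1 + real (Suc m) * (real (Suc l) + t)) ^ 3) *
          (\<integral>\<^sup>+v. u (t, v) * g ((real (Suc l) + t) / (1 + real (Suc m) * (real (Suc l) + t)), v / (1 + real (Suc m) * (real (Suc l) + t)))
          \<partial>unit_lborel))"
        by (simp add: nn_integral_suminf nn_integral_cmult del: of_nat_Suc)
      also have "\<dots> = (\<Sum>l. ennreal (1 / (real (Suc l) + t)^2) * K (1 / (real (Suc l) + t)))"
        unfolding K_def ennreal_suminf_cmult[symmetric]
      proof (intro suminf_cong)
        fix l m
        define z where "z = real (Suc l) + t"
        define M where "M = real (Suc m)"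
        have z: "0 < z" and M: "0 < M" using elim by (simp_all add: z_def M_def)
        have D: "0 < 1 + M * z" using z M by (simp add: add_pos_pos)
        have s: "M + 1 / z = (1 + M * z) / z" using z by (simp add: field_simps)
        have "1 / (1 + M * z) ^ 3 = 1 / z^2 * (1 / z / (M + 1 / z) ^ 3)"
          unfolding s using z D by (simp add: field_simps power3_eq_cube power2_eq_square)
        then have c: "ennreal (1 / (1 + M * z) ^ 3) = ennreal (1 / z^2) * ennreal (1 / z / (M + 1 / z) ^ 3)"
          using z M by (simp add: ennreal_mult[symmetric])
        have "1 / (M + 1 / z) = z / (1 + M * z)" "z * (M + 1 / z) = 1 + M * z"
          unfolding s using z D by (simp_all add: field_simps)
        moreover have "gauss_map (1 / z) = t" using elim gauss_map_inverse_branch(2)[of t l] by (simp add: z_def)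
        ultimately show "ennreal (1 / (1 + M * z) ^ 3) * (\<integral>\<^sup>+v. u (t, v) * g (z / (1 + M * z), v / (1 + M * z)) \<partial>unit_lborel)
          = ennreal (1 / z^2) * (ennreal (1 / z / (M + 1 / z)^3) *
           (\<integral>\<^sup>+v. u (gauss_map (1 / z), v) * g (1 / (M + 1 / z), 1 / z / (M + 1 / z) * v) \<partial>unit_lborel))"
          by (simp add: c mult.assoc)
      qed
      finally show ?case by simp
    qed
    finally show ?thesis by simp
  qed
  finally show ?thesis using LHS by simp
qed

section \<open>Invariant density\<close>

text \<open>
  The slow map has the invariant density \<open>1 / x\<close>, of infinite mass. The fast map moves to \<open>F_set\<close>
  and then makes one slow step, so the image under the slow map of this measure restricted to \<open>F_set\<close> is
  invariant under the fast map. It has the density \<open>1 / x - 1 / (x * (1 + x)^2)\<close>, where the subtracted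
  term is the image of the complement of \<open>F_set\<close>, on which the slow map is the red step with partial
  quotient 1. This difference is \<open>(2 + x) / (1 + x)^2\<close>, which is bounded.
\<close>

definition inv_density :: "real \<Rightarrow> real" where
  "inv_density x = (2 + x) / (1 + x)^2"

lemma inv_density_bounds:
  assumes "0 \<le> x" "x \<le> 1"
  shows "3/4 \<le> inv_density x" "inv_density x \<le> 2"
proof -
  have "(x - 1) * (3 * x + 5) \<le> 0" using assms by (intro mult_nonpos_nonneg) auto
  then have "3 * (1 + x)^2 \<le> 4 * (2 + x)" by (simp add: power2_eq_square algebra_simps)
  then show "3/4 \<le> inv_density x" using assms by (simp add: inv_density_def field_simps)
  have "0 \<le> x * x" by simp
  then have "2 + x \<le> 2 * (1 + x)^2" using assms by (simp add: power2_eq_square algebra_simps)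
  then show "inv_density x \<le> 2" using assms by (simp add: inv_density_def pos_divide_le_eq)
qed

lemma inv_density_eq:
  assumes "0 \<le> z"
  shows "inv_density z = 1 / (1 + z) + 1 / (1 + z)^2"
proof -
  have "1 / (1 + z) = (1 + z) / (1 + z)^2" using assms by (simp add: power2_eq_square)
  then show ?thesis unfolding inv_density_def by (simp add: add_divide_distrib[symmetric])
qed

lemma inv_density_decreasing:
  assumes "0 \<le> x" "x < y"
  shows "inv_density y < inv_density x"
proof -
  have "1 / (1 + y) < 1 / (1 + x)" "1 / (1 + y)^2 < 1 / (1 + x)^2"
    using assms by (intro divide_strict_left_mono power_strict_mono mult_pos_pos; simp)+
  then show ?thesis using assms by (simp add: inv_density_eq)
qed

lemma sums_telescope_inverse:
  fixes f :: "nat \<Rightarrow> real"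
  assumes "f \<longlonglongrightarrow> 0"
  shows "(\<lambda>n. f n - f (Suc n)) sums f 0"
  using telescope_sums'[OF assms] by simp

lemma suminf_ennreal_sums:
  assumes "f sums s" "\<And>n. 0 \<le> f n"
  shows "(\<Sum>n. ennreal (f n)) = ennreal s"
  using suminf_ennreal_eq[OF assms(2,1)] .

text \<open>
  With \<open>G x = 1 / x\<close> the density is \<open>G x - (1 + x)^(-3) * G (x / (1 + x))\<close>, so that the sum over the
  lengths of a red run telescopes; the remaining sums are telescoping after summation by parts.
\<close>

lemma transfer_inv_density:
  assumes t: "0 \<le> t"
  shows "transfer (\<lambda>p. ennreal (inv_density (fst p))) (t, v) = ennreal (inv_density t)"
proof -
  have lim: "(\<lambda>m. 1 / (z * (1 + (real m + 1) * z)^2)) \<longlonglongrightarrow> 0" if "0 < z" for z :: real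
    using that by real_asymp
  \<comment> \<open>the lower branches, summed over the first partial quotient only: this is the sum that telescopes\<close>
  have low: "(\<Sum>m. ennreal (1 / (1 + real (Suc m) * z) ^ 3) * ennreal (inv_density (z / (1 + real (Suc m) * z))))
      = ennreal (1 / (z * (1 + z)^2))" if z: "0 < z" for z :: real
  proof -
    let ?f = "\<lambda>m. 1 / (z * (1 + (real m + 1) * z)^2)"
    have eq: "1 / (1 + real (Suc m) * z) ^ 3 * inv_density (z / (1 + real (Suc m) * z)) = ?f m - ?f (Suc m)" for m
    proof -
      define D where "D = 1 + real (Suc m) * z"
      have D: "0 < D" using z by (simp add: D_def add_pos_nonneg)
      have "1 / D^3 * inv_density (z / D) = 1 / (z * D^2) - 1 / (z * (D + z)^2)"
      proof -
        have "1 + z / D = (D + z) / D" "2 + z / D = (2 * D + z) / D" using D by (simp_all add: field_simps)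
        then have "inv_density (z / D) = (2 * D + z) * D / (D + z)^2"
          using D z by (simp add: inv_density_def power2_eq_square)
        then have "1 / D^3 * inv_density (z / D) = (2 * D + z) / (D^2 * (D + z)^2)"
          using D z by (simp add: power2_eq_square power3_eq_cube)
        also have "\<dots> = ((D + z)^2 - D^2) / (z * D^2 * (D + z)^2)"
        proof -
          have "(D + z)^2 - D^2 = z * (2 * D + z)" by (simp add: power2_eq_square algebra_simps)
          then show ?thesis using z by simp
        qed
        also have "\<dots> = 1 / (z * D^2) - 1 / (z * (D + z)^2)"
          using D z by (simp add: diff_divide_distrib)
        finally show ?thesis .
      qed
      then show ?thesis by (simp add: D_def algebra_simps)
    qed
    have "0 \<le> 1 / (1 + real (Suc m) * z) ^ 3 * inv_density (z / (1 + real (Suc m) * z))" for m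
      using z by (simp add: inv_density_def)
    moreover from sums_telescope_inverse[OF lim[OF z]]
    have "(\<lambda>m. 1 / (1 + real (Suc m) * z) ^ 3 * inv_density (z / (1 + real (Suc m) * z))) sums (1 / (z * (1 + z)^2))"
      unfolding eq by simp
    ultimately have "(\<Sum>m. ennreal (1 / (1 + real (Suc m) * z) ^ 3 * inv_density (z / (1 + real (Suc m) * z)))) = ennreal (1 / (z * (1 + z)^2))"
      by (intro suminf_ennreal_sums)
    moreover have "0 \<le> 1 / (1 + real (Suc m) * z) ^ 3" for m using z by simp
    ultimately show ?thesis by (simp only: ennreal_mult'[symmetric])
  qed
  \<comment> \<open>the upper branches: the density does not depend on the strip, whence the factor \<open>Suc m\<close>\<close>
  have up: "ennreal (1 / (real (Suc m) + t) ^ 3) * (\<Sum>n<Suc m. ennreal (inv_density (1 / (real (Suc m) + t))))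
     = ennreal (real (Suc m) * (1 / (real (Suc m) + t)^2 - 1 / (real (Suc (Suc m)) + t)^2))" for m
  proof -
    define w where "w = real (Suc m) + t"
    have w: "0 < w" using t by (simp add: w_def)
    have "1 + 1 / w = (w + 1) / w" "2 + 1 / w = (2 * w + 1) / w" using w by (simp_all add: field_simps)
    then have "inv_density (1 / w) = (2 * w + 1) * w / (w + 1)^2"
      using w by (simp add: inv_density_def power2_eq_square)
    then have "1 / w^3 * inv_density (1 / w) = (2 * w + 1) / (w^2 * (w + 1)^2)"
      using w by (simp add: power2_eq_square power3_eq_cube)
    also have "\<dots> = ((w + 1)^2 - w^2) / (w^2 * (w + 1)^2)"
      by (simp add: power2_eq_square algebra_simps)
    also have "\<dots> = 1 / w^2 - 1 / (w + 1)^2"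
      using w by (simp add: diff_divide_distrib)
    finally have *: "1 / w^3 * (real (Suc m) * inv_density (1 / w)) = real (Suc m) * (1 / w^2 - 1 / (w + 1)^2)"
      by (simp only: mult.left_commute)
    have "0 \<le> inv_density (1 / w)" using w by (simp add: inv_density_def)
    then have "ennreal (1 / w ^ 3) * (\<Sum>n<Suc m. ennreal (inv_density (1 / w))) = ennreal (1 / w^3 * (real (Suc m) * inv_density (1 / w)))"
      using w by (simp add: ennreal_of_nat_eq_real_of_nat ennreal_mult[symmetric] del: of_nat_Suc)
    then show ?thesis unfolding * by (simp add: w_def add_ac)
  qed
  let ?a = "\<lambda>m. 1 / (real (Suc m) + t)^2"
  have sq_sum: "summable ?a"
  proof (rule summable_comparison_test')
    show "summable (\<lambda>n. inverse (real (Suc n)^2))"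
      using inverse_power_summable[of 2] by (subst summable_Suc_iff) auto
    show "norm (?a n) \<le> inverse (real (Suc n)^2)" for n
      using t by (simp add: inverse_eq_divide) (intro divide_left_mono power_mono, auto)
  qed
  \<comment> \<open>Abel summation absorbs the factor \<open>Suc m\<close>\<close>
  have up_sums: "(\<lambda>m. real (Suc m) * (?a m - ?a (Suc m))) sums (\<Sum>m. ?a m)"
  proof -
    have "(\<lambda>m. real m * ?a m) \<longlonglongrightarrow> 0" by real_asymp
    from sums_telescope_inverse[OF this]
    have "(\<lambda>m. real m * ?a m - real (Suc m) * ?a (Suc m)) sums 0" by simp
    from sums_add[OF summable_sums[OF sq_sum] this]
    have "(\<lambda>m. ?a m + (real m * ?a m - real (Suc m) * ?a (Suc m))) sums (\<Sum>m. ?a m)" by simp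
    moreover have "b + (real m * b - real (Suc m) * c) = real (Suc m) * (b - c)" for m and b c :: real
      by (simp add: algebra_simps)
    ultimately show ?thesis by (simp only:)
  qed
  have low_sums: "(\<lambda>l. 1 / ((real (Suc l) + t) * (1 + (real (Suc l) + t))^2) + ?a l) sums (inv_density t)"
  proof -
    have eq: "1 / ((real (Suc l) + t) * (1 + (real (Suc l) + t))^2) + ?a l =
       (1 / (real l + 1 + t) + 1 / (real l + 1 + t)^2) - (1 / (real (Suc l) + 1 + t) + 1 / (real (Suc l) + 1 + t)^2)" for l
    proof -
      define w where "w = real (Suc l) + t"
      have w: "0 < w" using t by (simp add: w_def)
      have "1 / (w * (1 + w)^2) = 1 / w - 1 / (w + 1) - 1 / (w + 1)^2"
      proof -
        have "1 / w - 1 / (w + 1) = (w + 1) / (w * (w + 1)^2)"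
          using w diff_frac_eq[of w "w + 1" 1 1] by (simp add: power2_eq_square)
        moreover have "1 / (w + 1)^2 = w / (w * (w + 1)^2)" using w by simp
        ultimately have "1 / w - 1 / (w + 1) - 1 / (w + 1)^2 = ((w + 1) - w) / (w * (w + 1)^2)"
          by (simp only: diff_divide_distrib)
        then show ?thesis by (simp add: add_ac)
      qed
      then show ?thesis by (simp add: w_def add_ac)
    qed
    have "(\<lambda>l. 1 / (real l + 1 + t) + 1 / (real l + 1 + t)^2) \<longlonglongrightarrow> 0" by real_asymp
    from sums_telescope_inverse[OF this] show ?thesis
      unfolding eq inv_density_eq[OF t] by simp
  qed
  have nn: "0 \<le> real (Suc m) * (?a m - ?a (Suc m))" for m
    using t by (intro mult_nonneg_nonneg) (auto intro!: divide_left_mono power_mono mult_pos_pos)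
  have "transfer (\<lambda>p. ennreal (inv_density (fst p))) (t, v) =
     (\<Sum>m. ennreal (real (Suc m) * (?a m - ?a (Suc m)))) +
     (\<Sum>l. ennreal (1 / ((real (Suc l) + t) * (1 + (real (Suc l) + t))^2)))"
    unfolding transfer_def prod.case fst_conv up using t by (subst low) (simp_all del: of_nat_Suc)
  also have "(\<Sum>m. ennreal (real (Suc m) * (?a m - ?a (Suc m)))) = ennreal (\<Sum>m. ?a m)"
    by (intro suminf_ennreal_sums up_sums nn)
  also have "\<dots> = (\<Sum>m. ennreal (?a m))"
    by (intro suminf_ennreal_sums[symmetric] summable_sums sq_sum) simp
  also have "\<dots> + (\<Sum>l. ennreal (1 / ((real (Suc l) + t) * (1 + (real (Suc l) + t))^2))) =
     (\<Sum>l. ennreal (1 / ((real (Suc l) + t) * (1 + (real (Suc l) + t))^2) + ?a l))"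
    using t by (subst suminf_add) (auto simp: add.commute ennreal_plus[symmetric] simp del: ennreal_plus)
  also have "\<dots> = ennreal (inv_density t)"
    using t by (intro suminf_ennreal_sums low_sums) simp
  finally show ?thesis .
qed

section \<open>The invariant measure\<close>

definition inv_measure :: "(real \<times> real) measure" where
  "inv_measure = density square_lborel (\<lambda>p. ennreal (inv_density (fst p)))"

lemma sets_inv_measure [simp, measurable_cong]: "sets inv_measure = sets borel"
  by (simp add: inv_measure_def)

lemma space_inv_measure [simp]: "space inv_measure = UNIV"
  by (simp add: inv_measure_def)

lemma borel_measurable_inv_density [measurable]: "inv_density \<in> borel_measurable borel"
  unfolding inv_density_def[abs_def] by measurable

lemma borel_measurable_inv_density_fst [simp]:
  "(\<lambda>p::real \<times> real. ennreal (inv_density (fst p))) \<in> borel_measurable borel"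
proof -
  have "(fst :: real \<times> real \<Rightarrow> real) \<in> borel_measurable borel"
    by (intro borel_measurable_continuous_onI continuous_intros)
  from measurable_compose[OF this, of "\<lambda>x. ennreal (inv_density x)" borel] show ?thesis by simp
qed

lemma AE_inv_measure: "(AE p in square_lborel. P p) \<longleftrightarrow> (AE p in inv_measure. P p)"
proof -
  have "AE p in square_lborel. ennreal (inv_density (fst p)) > 0"
    using AE_square_lborel by eventually_elim (simp add: inv_density_def)
  then have "(AE p in square_lborel. P p) \<longleftrightarrow> (AE p in square_lborel. 0 < ennreal (inv_density (fst p)) \<longrightarrow> P p)"
  proof (intro iffI)
    assume "AE p in square_lborel. P p"
    then show "AE p in square_lborel. 0 < ennreal (inv_density (fst p)) \<longrightarrow> P p" by eventually_elim simp
  next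
    assume "AE p in square_lborel. 0 < ennreal (inv_density (fst p)) \<longrightarrow> P p"
    with \<open>AE p in square_lborel. ennreal (inv_density (fst p)) > 0\<close>
    show "AE p in square_lborel. P p" by eventually_elim simp
  qed
  moreover have "(AE p in inv_measure. P p) \<longleftrightarrow> (AE p in square_lborel. 0 < ennreal (inv_density (fst p)) \<longrightarrow> P p)"
    unfolding inv_measure_def by (rule AE_density) (simp cong: measurable_cong_sets)
  ultimately show ?thesis by (simp only:)
qed

lemma nn_integral_inv_measure:
  assumes [measurable]: "f \<in> borel_measurable borel"
  shows "(\<integral>\<^sup>+p. f p \<partial>inv_measure) = (\<integral>\<^sup>+p. f p * ennreal (inv_density (fst p)) \<partial>square_lborel)"
proof -
  have "(\<integral>\<^sup>+p. f p \<partial>inv_measure) = (\<integral>\<^sup>+p. ennreal (inv_density (fst p)) * f p \<partial>square_lborel)"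
    unfolding inv_measure_def by (rule nn_integral_density) (simp_all add: assms cong: measurable_cong_sets)
  then show ?thesis by (simp only: mult.commute)
qed

lemma finite_inv_measure: "finite_measure inv_measure"
proof (rule finite_measureI)
  have "emeasure inv_measure UNIV = (\<integral>\<^sup>+p. 1 \<partial>inv_measure)" by simp
  also have "\<dots> \<le> (\<integral>\<^sup>+p. 2 \<partial>square_lborel)"
  proof (subst nn_integral_inv_measure, simp, intro nn_integral_mono_AE, use AE_square_lborel in eventually_elim)
    case (elim p)
    then have "ennreal (inv_density (fst p)) \<le> ennreal 2" by (intro ennreal_leI inv_density_bounds) auto
    then show ?case by simp
  qed
  also have "\<dots> = 2" by (simp add: emeasure_square_lborel_UNIV)
  finally have "emeasure inv_measure UNIV \<le> 2" .
  then show "emeasure inv_measure (space inv_measure) \<noteq> \<infinity>"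
    by (metis ennreal_numeral ennreal_less_top infinity_ennreal_def not_le space_inv_measure)
qed

theorem fast_map_preserves_inv_measure: "distr inv_measure inv_measure fast_map = inv_measure"
proof (rule measure_eqI)
  fix A assume "A \<in> sets (distr inv_measure inv_measure fast_map)"
  then have [measurable]: "A \<in> sets borel" by simp
  have "emeasure (distr inv_measure inv_measure fast_map) A = emeasure inv_measure (fast_map -` A)"
    by (subst emeasure_distr) auto
  also have "\<dots> = (\<integral>\<^sup>+p. indicator A (fast_map p) \<partial>inv_measure)"
  proof -
    have m: "fast_map -` A \<in> sets inv_measure"
      using measurable_sets[OF borel_measurable_fast_map, of A] by simp
    have "(\<lambda>p. indicator A (fast_map p)) = (indicator (fast_map -` A) :: _ \<Rightarrow> ennreal)"
      by (auto simp: indicator_def)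
    then show ?thesis using m by simp
  qed
  also have "\<dots> = (\<integral>\<^sup>+p. indicator A (fast_map p) * ennreal (inv_density (fst p)) \<partial>square_lborel)"
    by (rule nn_integral_inv_measure) measurable
  also have "\<dots> = (\<integral>\<^sup>+p. indicator A p * transfer (\<lambda>p. ennreal (inv_density (fst p))) p \<partial>square_lborel)"
    by (rule nn_integral_fast_map_transfer) simp_all
  also have "\<dots> = (\<integral>\<^sup>+p. indicator A p * ennreal (inv_density (fst p)) \<partial>square_lborel)"
  proof (intro nn_integral_cong_AE, use AE_square_lborel in eventually_elim)
    case (elim p)
    then have "transfer (\<lambda>p. ennreal (inv_density (fst p))) p = ennreal (inv_density (fst p))"
      using transfer_inv_density[of "fst p" "snd p"] by simp
    then show ?case by (rule arg_cong)
  qed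
  also have "\<dots> = (\<integral>\<^sup>+p. indicator A p \<partial>inv_measure)"
    by (rule nn_integral_inv_measure[symmetric]) measurable
  finally show "emeasure (distr inv_measure inv_measure fast_map) A = emeasure inv_measure A" by simp
qed simp

section \<open>Ergodicity\<close>

text \<open>
  Densities whose logarithm varies slowly. The distances \<open>|x - x'| / ((1 + x) * (1 + x'))\<close> and
  \<open>|y - y'| / (1 + x)\<close> are chosen because every inverse branch contracts them by the factors 4/9 and 2/3;
  Euclidean distances are not contracted uniformly, as \<open>t \<mapsto> 1 / (1 + t)\<close> has derivative -1 at 0. A single
  parameter controls both directions: one application of the transfer operator adds 6 (from the Jacobian)
  and \<open>4 * s\<close> (from the skewness of the branches) to \<open>4/9 * (11 + 18 * s)\<close>, which is at most
  \<open>11 + 18 * (2/3 * s)\<close>.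
\<close>

definition log_lipschitz :: "real \<Rightarrow> (real \<times> real \<Rightarrow> ennreal) \<Rightarrow> bool" where
  "log_lipschitz s g \<longleftrightarrow>
    (\<forall>x\<in>{0..1}. \<forall>y\<in>{0..1}. \<forall>y'\<in>{0..1}.
       g (x, y) \<le> ennreal (exp (s * (\<bar>y - y'\<bar> / (1 + x)))) * g (x, y')) \<and>
    (\<forall>x\<in>{0..1}. \<forall>x'\<in>{0..1}. \<forall>y\<in>{0..1}.
       g (x, y) \<le> ennreal (exp ((11 + 18 * s) * (\<bar>x - x'\<bar> / ((1 + x) * (1 + x'))))) * g (x', y))"

lemma suminf_ennreal_le_cmult:
  fixes f g :: "nat \<Rightarrow> ennreal"
  assumes "\<And>n. f n \<le> E * g n"
  shows "(\<Sum>n. f n) \<le> E * (\<Sum>n. g n)"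
  unfolding ennreal_suminf_cmult[symmetric] by (intro suminf_le assms) auto

lemma transfer_le:
  assumes up: "\<And>m n. n < Suc m \<Longrightarrow>
      ennreal (1 / (real (Suc m) + t) ^ 3) * g (1 / (real (Suc m) + t), 1 - (real n + v) / (real (Suc m) + t)) \<le>
      E * (ennreal (1 / (real (Suc m) + t') ^ 3) * g (1 / (real (Suc m) + t'), 1 - (real n + v') / (real (Suc m) + t')))"
    and low: "\<And>l m. ennreal (1 / (1 + real (Suc m) * (real (Suc l) + t)) ^ 3) *
        g ((real (Suc l) + t) / (1 + real (Suc m) * (real (Suc l) + t)), v / (1 + real (Suc m) * (real (Suc l) + t))) \<le>
      E * (ennreal (1 / (1 + real (Suc m) * (real (Suc l) + t')) ^ 3) *
        g ((real (Suc l) + t') / (1 + real (Suc m) * (real (Suc l) + t')), v' / (1 + real (Suc m) * (real (Suc l) + t'))))"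
  shows "transfer g (t, v) \<le> E * transfer g (t', v')"
proof -
  have "(\<Sum>m. ennreal (1 / (real (Suc m) + t) ^ 3) *
        (\<Sum>n<Suc m. g (1 / (real (Suc m) + t), 1 - (real n + v) / (real (Suc m) + t)))) \<le>
      E * (\<Sum>m. ennreal (1 / (real (Suc m) + t') ^ 3) *
        (\<Sum>n<Suc m. g (1 / (real (Suc m) + t'), 1 - (real n + v') / (real (Suc m) + t'))))"
    by (intro suminf_ennreal_le_cmult, simp only: sum_distrib_left, intro sum_mono up) simp
  moreover have "(\<Sum>l. \<Sum>m. ennreal (1 / (1 + real (Suc m) * (real (Suc l) + t)) ^ 3) *
        g ((real (Suc l) + t) / (1 + real (Suc m) * (real (Suc l) + t)), v / (1 + real (Suc m) * (real (Suc l) + t)))) \<le>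
      E * (\<Sum>l. \<Sum>m. ennreal (1 / (1 + real (Suc m) * (real (Suc l) + t')) ^ 3) *
        g ((real (Suc l) + t') / (1 + real (Suc m) * (real (Suc l) + t')), v' / (1 + real (Suc m) * (real (Suc l) + t'))))"
    by (intro suminf_ennreal_le_cmult low)
  ultimately show ?thesis
    unfolding transfer_def prod.case by (subst distrib_left) (rule add_mono)
qed

lemma contraction_four_ninths:
  fixes t t' A A' :: real
  assumes "0 \<le> t" "0 \<le> t'" "3/2 * (1 + t) \<le> A" "3/2 * (1 + t') \<le> A'"
  shows "\<bar>t - t'\<bar> / (A * A') \<le> 4/9 * (\<bar>t - t'\<bar> / ((1 + t) * (1 + t')))"
proof -
  define Q where "Q = (1 + t) * (1 + t')"
  have "(3/2 * (1 + t)) * (3/2 * (1 + t')) \<le> A * A'" using assms by (intro mult_mono) auto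
  then have "9/4 * Q \<le> A * A'" unfolding Q_def by (simp add: algebra_simps)
  moreover have "0 < Q" unfolding Q_def using assms by (intro mult_pos_pos) auto
  ultimately have "\<bar>t - t'\<bar> / (A * A') \<le> \<bar>t - t'\<bar> / (9/4 * Q)"
    using assms by (intro divide_left_mono mult_pos_pos) auto
  then show ?thesis unfolding Q_def[symmetric] by simp
qed

lemma contraction_two_thirds:
  fixes t A :: real
  assumes "0 \<le> t" "3/2 * (1 + t) \<le> A" "0 \<le> d"
  shows "d / A \<le> 2/3 * (d / (1 + t))"
proof -
  define Q where "Q = 1 + t"
  have "d / A \<le> d / (3/2 * Q)" unfolding Q_def using assms by (intro divide_left_mono mult_pos_pos) auto
  then show ?thesis unfolding Q_def[symmetric] by simp
qed

lemma abs_diff_le_scaled: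
  fixes t t' :: real
  assumes "t \<in> {0..1}" "t' \<in> {0..1}"
  shows "\<bar>t - t'\<bar> / (1 + t) \<le> 2 * (\<bar>t - t'\<bar> / ((1 + t) * (1 + t')))"
    "\<bar>t - t'\<bar> \<le> 4 * (\<bar>t - t'\<bar> / ((1 + t) * (1 + t')))"
proof -
  define R where "R = \<bar>t - t'\<bar> / (1 + t)"
  define W where "W = \<bar>t - t'\<bar> / ((1 + t) * (1 + t'))"
  have W: "W = R / (1 + t')" by (simp add: R_def W_def)
  have "R / 2 \<le> W" unfolding W R_def using assms by (intro divide_left_mono) auto
  then have RW: "R \<le> 2 * W" by simp
  then show "\<bar>t - t'\<bar> / (1 + t) \<le> 2 * (\<bar>t - t'\<bar> / ((1 + t) * (1 + t')))" unfolding R_def W_def .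
  have "\<bar>t - t'\<bar> / 2 \<le> R" unfolding R_def using assms by (intro divide_left_mono) auto
  then have "\<bar>t - t'\<bar> \<le> 4 * W" using RW by simp
  then show "\<bar>t - t'\<bar> \<le> 4 * (\<bar>t - t'\<bar> / ((1 + t) * (1 + t')))" unfolding W_def .
qed

text \<open>
  The logarithmic derivative \<open>c / (d + c * t)\<close> of a denominator is at most \<open>1 / (1 + t)\<close> as soon as
  \<open>c \<le> d\<close>. The bound does not depend on \<open>c\<close> and \<open>d\<close>, hence not on the branch.
\<close>

lemma denominator_distortion:
  fixes c d t t' :: real
  assumes c: "0 \<le> c" "c \<le> d" and t: "t \<in> {0..1}" "t' \<in> {0..1}"
  shows "d + c * t' \<le> exp (2 * (\<bar>t - t'\<bar> / ((1 + t) * (1 + t')))) * (d + c * t)"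
proof -
  have "c * (1 + t) \<le> d + c * t" using c by (simp add: algebra_simps)
  then have "c \<le> (d + c * t) / (1 + t)" using t by (simp add: pos_le_divide_eq)
  then have "c * \<bar>t - t'\<bar> \<le> (d + c * t) / (1 + t) * \<bar>t - t'\<bar>" by (intro mult_right_mono) auto
  moreover have "c * (t' - t) \<le> c * \<bar>t - t'\<bar>" using c by (intro mult_left_mono) auto
  ultimately have "d + c * t' \<le> (1 + \<bar>t - t'\<bar> / (1 + t)) * (d + c * t)" by (simp add: algebra_simps)
  also have "\<dots> \<le> exp (2 * (\<bar>t - t'\<bar> / ((1 + t) * (1 + t')))) * (d + c * t)"
  proof (intro mult_right_mono)
    show "1 + \<bar>t - t'\<bar> / (1 + t) \<le> exp (2 * (\<bar>t - t'\<bar> / ((1 + t) * (1 + t'))))"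
      using abs_diff_le_scaled(1)[OF t] exp_ge_add_one_self[of "2 * (\<bar>t - t'\<bar> / ((1 + t) * (1 + t')))"] by linarith
  qed (use c t in auto)
  finally show ?thesis .
qed

lemma log_lipschitz_branch_vertical:
  assumes g: "log_lipschitz s g" and s: "0 \<le> s"
    and XY: "X \<in> {0..1}" "Y \<in> {0..1}" "Y' \<in> {0..1}"
    and le: "\<bar>Y - Y'\<bar> / (1 + X) \<le> 2/3 * d"
  shows "J * g (X, Y) \<le> ennreal (exp (2/3 * s * d)) * (J * g (X, Y'))"
proof -
  have "g (X, Y) \<le> ennreal (exp (s * (\<bar>Y - Y'\<bar> / (1 + X)))) * g (X, Y')"
    using g XY unfolding log_lipschitz_def by blast
  also have "\<dots> \<le> ennreal (exp (2/3 * s * d)) * g (X, Y')"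
    using mult_left_mono[OF le s] by (intro mult_right_mono ennreal_leI) (auto simp: mult_ac)
  finally have "J * g (X, Y) \<le> J * (ennreal (exp (2/3 * s * d)) * g (X, Y'))" by (rule mult_left_mono) simp
  then show ?thesis by (simp add: mult_ac)
qed

text \<open>
  A horizontal displacement of the argument moves a branch point in three ways, which are estimated
  in turn: its weight \<open>1 / D ^ 3\<close> changes, and so do its first and its second coordinate.
\<close>

lemma log_lipschitz_branch_horizontal:
  assumes g: "log_lipschitz s g" and s: "0 \<le> s"
    and XY: "X \<in> {0..1}" "X' \<in> {0..1}" "Y \<in> {0..1}" "Y' \<in> {0..1}"
    and D: "0 < D" "0 < D'" "D' \<le> exp (2 * d) * D"
    and X: "\<bar>X - X'\<bar> / ((1 + X) * (1 + X')) \<le> 4/9 * d" and Y: "\<bar>Y - Y'\<bar> \<le> 4 * d"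
  shows "ennreal (1 / D ^ 3) * g (X, Y) \<le> ennreal (exp ((11 + 18 * (2/3 * s)) * d)) * (ennreal (1 / D' ^ 3) * g (X', Y'))"
proof -
  have d: "0 \<le> d" using Y by (smt (verit) abs_ge_zero)
  have "g (X, Y) \<le> ennreal (exp ((11 + 18 * s) * (\<bar>X - X'\<bar> / ((1 + X) * (1 + X'))))) * g (X', Y)"
    using g XY unfolding log_lipschitz_def by blast
  also have "\<dots> \<le> ennreal (exp ((11 + 18 * s) * (4/9 * d))) * g (X', Y)"
    using mult_left_mono[OF X, of "11 + 18 * s"] s by (intro mult_right_mono ennreal_leI) simp_all
  finally have g1: "g (X, Y) \<le> ennreal (exp ((11 + 18 * s) * (4/9 * d))) * g (X', Y)" .
  have "g (X', Y) \<le> ennreal (exp (s * (\<bar>Y - Y'\<bar> / (1 + X')))) * g (X', Y')"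
    using g XY unfolding log_lipschitz_def by blast
  also have "\<dots> \<le> ennreal (exp (s * (4 * d))) * g (X', Y')"
  proof (intro mult_right_mono ennreal_leI)
    have "\<bar>Y - Y'\<bar> / (1 + X') \<le> \<bar>Y - Y'\<bar> / 1" using XY by (intro divide_left_mono) auto
    then have "\<bar>Y - Y'\<bar> / (1 + X') \<le> 4 * d" using Y by simp
    from mult_left_mono[OF this s] show "exp (s * (\<bar>Y - Y'\<bar> / (1 + X'))) \<le> exp (s * (4 * d))" by simp
  qed simp
  finally have g2: "g (X', Y) \<le> ennreal (exp (s * (4 * d))) * g (X', Y')" .
  have gle: "g (X, Y) \<le> ennreal (exp ((11 + 18 * s) * (4/9 * d))) * (ennreal (exp (s * (4 * d))) * g (X', Y'))"
    by (rule order_trans[OF g1 mult_left_mono[OF g2]]) simp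
  have "D' ^ 3 \<le> (exp (2 * d) * D) ^ 3" using D by (intro power_mono) auto
  also have "\<dots> = exp (6 * d) * D ^ 3"
    using exp_of_nat_mult[of 3 "2 * d"] by (simp add: power_mult_distrib)
  finally have "1 / D ^ 3 \<le> exp (6 * d) * (1 / D' ^ 3)"
    using D by (simp add: field_simps)
  then have "ennreal (1 / D ^ 3) \<le> ennreal (exp (6 * d)) * ennreal (1 / D' ^ 3)"
    by (simp only: ennreal_mult'[symmetric] exp_ge_zero) (rule ennreal_leI)
  from mult_mono[OF this gle]
  have "ennreal (1 / D ^ 3) * g (X, Y) \<le> ennreal (exp (6 * d)) * ennreal (1 / D' ^ 3) *
      (ennreal (exp ((11 + 18 * s) * (4/9 * d))) * (ennreal (exp (s * (4 * d))) * g (X', Y')))" by simp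
  also have "\<dots> = (ennreal (exp (6 * d)) * ennreal (exp ((11 + 18 * s) * (4/9 * d))) * ennreal (exp (s * (4 * d)))) *
      (ennreal (1 / D' ^ 3) * g (X', Y'))" by (simp only: mult_ac)
  also have "ennreal (exp (6 * d)) * ennreal (exp ((11 + 18 * s) * (4/9 * d))) * ennreal (exp (s * (4 * d))) =
      ennreal (exp (6 * d + (11 + 18 * s) * (4/9 * d) + s * (4 * d)))"
    by (simp only: ennreal_mult exp_ge_zero exp_add mult_nonneg_nonneg)
  also have "\<dots> * (ennreal (1 / D' ^ 3) * g (X', Y')) \<le> ennreal (exp ((11 + 18 * (2/3 * s)) * d)) * (ennreal (1 / D' ^ 3) * g (X', Y'))"
    using d by (intro mult_right_mono ennreal_leI) (auto simp: algebra_simps)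
  finally show ?thesis .
qed

theorem log_lipschitz_transfer:
  assumes g: "log_lipschitz s g" and s: "0 \<le> s"
  shows "log_lipschitz (2/3 * s) (transfer g)"
  unfolding log_lipschitz_def
proof (intro conjI ballI)
  fix t v v' :: real assume t: "t \<in> {0..1}" and v: "v \<in> {0..1}" "v' \<in> {0..1}"
  show "transfer g (t, v) \<le> ennreal (exp (2/3 * s * (\<bar>v - v'\<bar> / (1 + t)))) * transfer g (t, v')"
  proof (rule transfer_le; rule log_lipschitz_branch_vertical[OF g s])
    fix m n assume n: "n < Suc m"
    define w where "w = real (Suc m) + t"
    have w: "1 \<le> w" "1 + t \<le> w" "0 < w" using t by (simp_all add: w_def)
    have nv: "0 \<le> real n + v" "real n + v \<le> w" "0 \<le> real n + v'" "real n + v' \<le> w" using v n t by (auto simp: w_def)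
    show "1 / w \<in> {0..1}" "1 - (real n + v) / w \<in> {0..1}" "1 - (real n + v') / w \<in> {0..1}"
      using nv w by (auto simp: divide_le_eq)
    have "\<bar>1 - (real n + v) / w - (1 - (real n + v') / w)\<bar> = \<bar>v - v'\<bar> / w"
    proof -
      have "1 - (real n + v) / w - (1 - (real n + v') / w) = (v' - v) / w"
        using w by (simp add: diff_divide_distrib add_divide_distrib)
      then show ?thesis using w by (simp add: abs_minus_commute)
    qed
    moreover have "1 + 1 / w = (w + 1) / w" using w by (simp add: field_simps)
    ultimately have "\<bar>1 - (real n + v) / w - (1 - (real n + v') / w)\<bar> / (1 + 1 / w) = \<bar>v - v'\<bar> / (w + 1)"
      using w by simp
    also have "\<dots> \<le> 2/3 * (\<bar>v - v'\<bar> / (1 + t))" using w t by (intro contraction_two_thirds) auto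
    finally show "\<bar>1 - (real n + v) / w - (1 - (real n + v') / w)\<bar> / (1 + 1 / w) \<le> 2/3 * (\<bar>v - v'\<bar> / (1 + t))" .
  next
    fix l m
    define z where "z = real (Suc l) + t"
    define M where "M = real (Suc m)"
    define D where "D = 1 + M * z"
    have z: "1 + t \<le> z" "0 < z" using t by (simp_all add: z_def)
    have "1 * z \<le> M * z" using z by (intro mult_right_mono) (auto simp: M_def)
    then have "1 + z \<le> D" by (simp add: D_def)
    then have D: "1 + z \<le> D" "1 \<le> D" "0 < D" using z by simp_all
    show "z / D \<in> {0..1}" "v / D \<in> {0..1}" "v' / D \<in> {0..1}" using D z v by (auto simp: divide_le_eq)
    have "\<bar>v / D - v' / D\<bar> = \<bar>v - v'\<bar> / D" using D by (simp add: diff_divide_distrib[symmetric])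
    moreover have "1 + z / D = (D + z) / D" using D by (simp add: field_simps)
    ultimately have "\<bar>v / D - v' / D\<bar> / (1 + z / D) = \<bar>v - v'\<bar> / (D + z)" using D by simp
    also have "\<dots> \<le> 2/3 * (\<bar>v - v'\<bar> / (1 + t))" using D z t by (intro contraction_two_thirds) auto
    finally show "\<bar>v / D - v' / D\<bar> / (1 + z / D) \<le> 2/3 * (\<bar>v - v'\<bar> / (1 + t))" .
  qed
next
  fix t t' v :: real assume t: "t \<in> {0..1}" "t' \<in> {0..1}" and v: "v \<in> {0..1}"
  define d where "d = \<bar>t - t'\<bar> / ((1 + t) * (1 + t'))"
  have "transfer g (t, v) \<le> ennreal (exp ((11 + 18 * (2/3 * s)) * d)) * transfer g (t', v)"
  proof (rule transfer_le; rule log_lipschitz_branch_horizontal[OF g s])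
    fix m n assume n: "n < Suc m"
    define w w' where "w = real (Suc m) + t" and "w' = real (Suc m) + t'"
    have w: "1 \<le> w" "1 + t \<le> w" "0 < w" and w': "1 \<le> w'" "1 + t' \<le> w'" "0 < w'"
      using t by (simp_all add: w_def w'_def)
    have nv: "0 \<le> real n + v" "real n + v \<le> w" "real n + v \<le> w'" using v n t by (auto simp: w_def w'_def)
    show "1 / w \<in> {0..1}" "1 / w' \<in> {0..1}" "1 - (real n + v) / w \<in> {0..1}" "1 - (real n + v) / w' \<in> {0..1}" "0 < w" "0 < w'"
      using nv w w' by (auto simp: divide_le_eq)
    show "w' \<le> exp (2 * d) * w"
      unfolding d_def w_def w'_def using denominator_distortion[of 1 "real (Suc m)" t t'] t by simp
    have inv: "1 / w - 1 / w' = (t' - t) / (w * w')" using w w' by (simp add: w_def w'_def field_simps)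
    have "1 + 1 / w = (w + 1) / w" "1 + 1 / w' = (w' + 1) / w'" using w w' by (simp_all add: field_simps)
    then have "\<bar>1 / w - 1 / w'\<bar> / ((1 + 1 / w) * (1 + 1 / w')) = \<bar>t - t'\<bar> / ((w + 1) * (w' + 1))"
      unfolding inv using w w' by (simp add: abs_mult abs_minus_commute)
    also have "\<dots> \<le> 4/9 * d" unfolding d_def using w w' t by (intro contraction_four_ninths) auto
    finally show "\<bar>1 / w - 1 / w'\<bar> / ((1 + 1 / w) * (1 + 1 / w')) \<le> 4/9 * d" .
    have "(1 - N / w) - (1 - N / w') = - N * (1 / w - 1 / w')" for N :: real
      by (simp add: algebra_simps)
    from this[of "real n + v"]
    have "(1 - (real n + v) / w) - (1 - (real n + v) / w') = - (real n + v) * (1 / w - 1 / w')" .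
    also have "\<bar>\<dots>\<bar> = (real n + v) / w * (\<bar>t - t'\<bar> / w')"
      unfolding inv using w w' nv by (simp add: abs_mult abs_minus_commute)
    also have "\<dots> \<le> 1 * (\<bar>t - t'\<bar> / 1)"
      using w w' nv by (intro mult_mono divide_left_mono) auto
    also have "\<dots> \<le> 4 * d" unfolding d_def using abs_diff_le_scaled(2)[OF t] by simp
    finally show "\<bar>1 - (real n + v) / w - (1 - (real n + v) / w')\<bar> \<le> 4 * d" .
  next
    fix l m
    define z z' where "z = real (Suc l) + t" and "z' = real (Suc l) + t'"
    define M where "M = real (Suc m)"
    define D D' where "D = 1 + M * z" and "D' = 1 + M * z'"
    have M: "1 \<le> M" by (simp add: M_def)
    have z: "1 + t \<le> z" "0 < z" "1 \<le> z" and z': "1 + t' \<le> z'" "0 < z'" "1 \<le> z'" using t by (simp_all add: z_def z'_def)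
    have "1 * z \<le> M * z" "M * 1 \<le> M * z" "1 * z' \<le> M * z'" using M z z' by (intro mult_right_mono mult_left_mono; simp)+
    then have "1 + z \<le> D" "M \<le> D" "1 + z' \<le> D'" by (simp_all add: D_def D'_def)
    then have D: "1 + z \<le> D" "1 \<le> D" "0 < D" "M \<le> D" and D': "1 + z' \<le> D'" "1 \<le> D'" "0 < D'"
      using z z' by simp_all
    have "z / D \<in> {0..1}" "z' / D' \<in> {0..1}" "v / D \<in> {0..1}" "v / D' \<in> {0..1}" "0 < D" "0 < D'"
      using D z v D' z' by (auto simp: divide_le_eq)
    moreover have "D' \<le> exp (2 * d) * D"
    proof -
      have "M * 1 \<le> M * real (Suc l)" using M by (intro mult_left_mono) auto
      then have "M \<le> 1 + M * real (Suc l)" by linarith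
      then show ?thesis
        using denominator_distortion[of M "1 + M * real (Suc l)" t t'] t M
        by (simp add: d_def D_def D'_def z_def z'_def algebra_simps del: of_nat_Suc)
    qed
    moreover have "\<bar>z / D - z' / D'\<bar> / ((1 + z / D) * (1 + z' / D')) \<le> 4/9 * d"
    proof -
      have "z * D' - z' * D = t - t'" by (simp add: D_def D'_def z_def z'_def algebra_simps)
      then have "z / D - z' / D' = (t - t') / (D * D')" using D D' by (simp add: diff_frac_eq)
      moreover have "1 + z / D = (D + z) / D" "1 + z' / D' = (D' + z') / D'" using D D' by (simp_all add: field_simps)
      ultimately have "\<bar>z / D - z' / D'\<bar> / ((1 + z / D) * (1 + z' / D')) = \<bar>t - t'\<bar> / ((D + z) * (D' + z'))"
        using D D' by (simp add: abs_mult)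
      also have "\<dots> \<le> 4/9 * d" unfolding d_def using D D' z z' t by (intro contraction_four_ninths) auto
      finally show ?thesis .
    qed
    moreover have "\<bar>v / D - v / D'\<bar> \<le> 4 * d"
    proof -
      have "D' - D = M * (t' - t)" by (simp add: D_def D'_def z_def z'_def algebra_simps)
      then have "v / D - v / D' = v * (M * (t' - t)) / (D * D')"
        using D D' by (simp add: diff_frac_eq right_diff_distrib[symmetric])
      then have "\<bar>v / D - v / D'\<bar> = v * (M / D * (\<bar>t - t'\<bar> / D'))"
        using D D' M v by (simp add: abs_mult abs_minus_commute)
      also have "\<dots> \<le> 1 * (1 * (\<bar>t - t'\<bar> / 1))"
        using D D' M v by (intro mult_mono divide_left_mono) auto
      also have "\<dots> \<le> 4 * d" unfolding d_def using abs_diff_le_scaled(2)[OF t] by simp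
      finally show ?thesis .
    qed
    ultimately show "z / D \<in> {0..1}" "z' / D' \<in> {0..1}" "v / D \<in> {0..1}" "v / D' \<in> {0..1}" "0 < D" "0 < D'"
      "D' \<le> exp (2 * d) * D" "\<bar>z / D - z' / D'\<bar> / ((1 + z / D) * (1 + z' / D')) \<le> 4/9 * d" "\<bar>v / D - v / D'\<bar> \<le> 4 * d"
      by auto
  qed
  then show "transfer g (t, v) \<le> ennreal (exp ((11 + 18 * (2/3 * s)) * (\<bar>t - t'\<bar> / ((1 + t) * (1 + t'))))) * transfer g (t', v)"
    by (simp add: d_def)
qed

lemma log_lipschitz_funpow_transfer:
  assumes "log_lipschitz s g" "0 \<le> s"
  shows "log_lipschitz ((2/3) ^ k * s) ((transfer ^^ k) g)"
proof (induction k)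
  case (Suc k) then show ?case
    using log_lipschitz_transfer[OF Suc] assms by (simp add: mult.assoc)
qed (use assms in simp)

text \<open>
  The exponents add up to at most \<open>1 + (11 + 18) = 30\<close>. What matters is that the bound is the same for
  all densities with parameter at most 1.
\<close>

lemma log_lipschitz_oscillation:
  assumes g: "log_lipschitz s g" and s: "0 \<le> s" "s \<le> 1" and p: "p \<in> {0..1} \<times> {0..1}" "p' \<in> {0..1} \<times> {0..1}"
  shows "g p \<le> ennreal (exp 30) * g p'"
proof -
  obtain x y x' y' where [simp]: "p = (x, y)" "p' = (x', y')" by (cases p, cases p')
  have xy: "x \<in> {0..1}" "y \<in> {0..1}" "x' \<in> {0..1}" "y' \<in> {0..1}" using p by auto
  have "\<bar>y - y'\<bar> / (1 + x) \<le> 1 / 1" using xy by (intro frac_le) auto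
  then have "s * (\<bar>y - y'\<bar> / (1 + x)) \<le> 1 * 1" using s xy by (intro mult_mono) auto
  moreover have "g (x, y) \<le> ennreal (exp (s * (\<bar>y - y'\<bar> / (1 + x)))) * g (x, y')"
    using g xy unfolding log_lipschitz_def by blast
  ultimately have 1: "g (x, y) \<le> ennreal (exp 1) * g (x, y')"
    by (elim order_trans) (intro mult_right_mono ennreal_leI; simp)
  have "1 * 1 \<le> (1 + x) * (1 + x')" using xy by (intro mult_mono) auto
  then have "\<bar>x - x'\<bar> / ((1 + x) * (1 + x')) \<le> 1 / 1" using xy by (intro frac_le) auto
  then have "(11 + 18 * s) * (\<bar>x - x'\<bar> / ((1 + x) * (1 + x'))) \<le> 29 * 1" using s xy by (intro mult_mono) auto
  moreover have "g (x, y') \<le> ennreal (exp ((11 + 18 * s) * (\<bar>x - x'\<bar> / ((1 + x) * (1 + x'))))) * g (x', y')"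
    using g xy unfolding log_lipschitz_def by blast
  ultimately have 2: "g (x, y') \<le> ennreal (exp 29) * g (x', y')"
    by (elim order_trans) (intro mult_right_mono ennreal_leI; simp)
  have "g (x, y) \<le> ennreal (exp 1) * (ennreal (exp 29) * g (x', y'))"
    using 1 mult_left_mono[OF 2, of "ennreal (exp 1)"] by (auto intro: order_trans)
  also have "\<dots> = ennreal (exp 1 * exp 29) * g (x', y')"
    by (simp add: ennreal_mult mult.assoc)
  also have "exp 1 * exp 29 = (exp 30 :: real)" by (simp add: exp_add[symmetric])
  finally show ?thesis by simp
qed

lemma log_lipschitz_exp_infdist:
  assumes j: "0 \<le> j"
  shows "log_lipschitz (2 * j) (\<lambda>p. ennreal (exp (- j * infdist p K)))"
  unfolding log_lipschitz_def
proof (intro conjI ballI)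
  have gen: "ennreal (exp (- j * infdist p K)) \<le> ennreal (exp r) * ennreal (exp (- j * infdist p' K))"
    if "j * dist p p' \<le> r" for p p' :: "real \<times> real" and r
  proof -
    have "infdist p' K \<le> infdist p K + dist p' p" by (rule infdist_triangle)
    then have "j * infdist p' K \<le> j * (infdist p K + dist p' p)" using j by (intro mult_left_mono)
    then have "- j * infdist p K \<le> r + - j * infdist p' K" using that by (simp add: algebra_simps dist_commute)
    then have "exp (- j * infdist p K) \<le> exp r * exp (- j * infdist p' K)" by (simp add: exp_add[symmetric])
    then show ?thesis by (simp only: ennreal_mult'[symmetric] exp_ge_zero) (rule ennreal_leI)
  qed
  fix x y z :: real assume xyz: "x \<in> {0..1}" "y \<in> {0..1}" "z \<in> {0..1}"
  have "\<bar>y - z\<bar> / 2 \<le> \<bar>y - z\<bar> / (1 + x)" using xyz by (intro divide_left_mono) auto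
  from mult_left_mono[OF this, of "2 * j"] have "j * \<bar>y - z\<bar> \<le> 2 * j * (\<bar>y - z\<bar> / (1 + x))" using j by simp
  then show "ennreal (exp (- j * infdist (x, y) K)) \<le> ennreal (exp (2 * j * (\<bar>y - z\<bar> / (1 + x)))) * ennreal (exp (- j * infdist (x, z) K))"
    by (intro gen) (simp add: dist_Pair_Pair dist_real_def)
  have "j * \<bar>x - y\<bar> \<le> j * (4 * (\<bar>x - y\<bar> / ((1 + x) * (1 + y))))"
    using j abs_diff_le_scaled(2)[OF xyz(1,2)] by (intro mult_left_mono) auto
  also have "\<dots> = (4 * j) * (\<bar>x - y\<bar> / ((1 + x) * (1 + y)))" by simp
  also have "\<dots> \<le> (11 + 18 * (2 * j)) * (\<bar>x - y\<bar> / ((1 + x) * (1 + y)))" using xyz j by (intro mult_right_mono) auto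
  finally show "ennreal (exp (- j * infdist (x, z) K)) \<le> ennreal (exp ((11 + 18 * (2 * j)) * (\<bar>x - y\<bar> / ((1 + x) * (1 + y))))) * ennreal (exp (- j * infdist (y, z) K))"
    by (intro gen) (simp add: dist_Pair_Pair dist_real_def)
qed

lemma nn_integral_invariant_set_transfer:
  assumes [measurable]: "A \<in> sets borel" "g \<in> borel_measurable borel" and inv: "fast_map -` A = A"
  shows "(\<integral>\<^sup>+p. indicator A p * (transfer ^^ k) g p \<partial>square_lborel) = (\<integral>\<^sup>+p. indicator A p * g p \<partial>square_lborel)"
proof (induction k)
  case (Suc k)
  have [measurable]: "(transfer ^^ k) g \<in> borel_measurable borel" by (induction k) auto
  have "indicator A (fast_map p) = (indicator A p :: ennreal)" for p
    using inv by (auto simp: indicator_def)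
  then show ?case
    using nn_integral_fast_map_transfer[of "indicator A" "(transfer ^^ k) g"] Suc by simp
qed simp

text \<open>
  Iterating the transfer operator does not change \<open>\<integral> 1\<^sub>A * g\<close> for an invariant set, but makes \<open>g\<close>
  comparable to the constant \<open>\<integral> g\<close>, with a constant that depends neither on \<open>g\<close> nor on \<open>A\<close>. So the part of \<open>g\<close>
  that lives on \<open>A\<close> is at least proportional to the measure of \<open>A\<close>.
\<close>

lemma invariant_set_lower_bound:
  assumes A [measurable]: "A \<in> sets borel" and g [measurable]: "g \<in> borel_measurable borel"
    and inv: "fast_map -` A = A" and lip: "log_lipschitz s g" "0 \<le> s"
  shows "emeasure square_lborel A * (\<integral>\<^sup>+p. g p \<partial>square_lborel) \<le> ennreal (exp 30) * (\<integral>\<^sup>+p. indicator A p * g p \<partial>square_lborel)"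
proof -
  obtain k where k: "(2/3) ^ k * s \<le> 1"
  proof -
    have "(\<lambda>k. (2/3) ^ k * s) \<longlonglongrightarrow> 0 * s" by (intro tendsto_intros LIMSEQ_power_zero) auto
    then have "eventually (\<lambda>k. (2/3) ^ k * s < 1) sequentially" by (rule order_tendstoD) simp
    then show ?thesis using that by (auto simp: eventually_sequentially intro: less_imp_le)
  qed
  let ?g = "(transfer ^^ k) g"
  have [measurable]: "?g \<in> borel_measurable borel" by (induction k) auto
  have osc: "?g p \<le> ennreal (exp 30) * ?g p'" if "p \<in> {0..1} \<times> {0..1}" "p' \<in> {0..1} \<times> {0..1}" for p p'
    using that k lip by (intro log_lipschitz_oscillation[OF log_lipschitz_funpow_transfer[OF lip]]) auto
  have AE_sq: "AE p in square_lborel. p \<in> {0..1} \<times> {0..1}"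
    using AE_square_lborel by eventually_elim (auto simp: mem_Times_iff)
  have int_le: "(\<integral>\<^sup>+p. g p \<partial>square_lborel) \<le> ennreal (exp 30) * ?g p'" if "p' \<in> {0..1} \<times> {0..1}" for p'
  proof -
    have "(\<integral>\<^sup>+p. g p \<partial>square_lborel) = (\<integral>\<^sup>+p. ?g p \<partial>square_lborel)"
      using nn_integral_invariant_set_transfer[of UNIV g k] by simp
    also have "\<dots> \<le> (\<integral>\<^sup>+p. ennreal (exp 30) * ?g p' \<partial>square_lborel)"
      by (intro nn_integral_mono_AE, use AE_sq in eventually_elim) (rule osc[OF _ that])
    finally show ?thesis by (simp add: emeasure_square_lborel_UNIV)
  qed
  have "emeasure square_lborel A * (\<integral>\<^sup>+p. g p \<partial>square_lborel) = (\<integral>\<^sup>+p'. (\<integral>\<^sup>+p. g p \<partial>square_lborel) * indicator A p' \<partial>square_lborel)"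
    by (subst nn_integral_cmult_indicator) (auto simp: mult.commute)
  also have "\<dots> \<le> (\<integral>\<^sup>+p'. ennreal (exp 30) * (indicator A p' * ?g p') \<partial>square_lborel)"
    by (intro nn_integral_mono_AE, use AE_sq in eventually_elim) (auto simp: indicator_def int_le)
  also have "\<dots> = ennreal (exp 30) * (\<integral>\<^sup>+p. indicator A p * g p \<partial>square_lborel)"
    by (subst nn_integral_cmult) (auto simp: nn_integral_invariant_set_transfer[OF A g inv])
  finally show ?thesis .
qed

text \<open>
  If the complement of \<open>A\<close> had positive measure, it would contain a compact set \<open>K\<close> of positive measure.
  The functions \<open>exp (- j * infdist p K)\<close> are log-Lipschitz and decrease to the indicator of \<open>K\<close>, which
  vanishes on \<open>A\<close>; the lower bound then forces \<open>A\<close> to be a null set.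
\<close>

theorem fast_map_ergodic:
  assumes A [measurable]: "A \<in> sets borel" and inv: "fast_map -` A = A"
  shows "emeasure square_lborel A = 0 \<or> emeasure square_lborel (- A) = 0"
proof (rule disjCI)
  assume pos: "emeasure square_lborel (- A) \<noteq> 0"
  have "emeasure square_lborel (- A) = (SUP K \<in> {K. K \<subseteq> - A \<and> compact K}. emeasure square_lborel K)"
    by (rule inner_regular) (auto simp: emeasure_square_lborel_UNIV)
  then obtain K where K: "K \<subseteq> - A" "compact K" and Kpos: "emeasure square_lborel K \<noteq> 0"
    using pos by (metis (no_types, lifting) SUP_bot_conv(2) bot_ennreal mem_Collect_eq)
  have cl: "closed K" using K by (intro compact_imp_closed)
  then have [measurable]: "K \<in> sets borel" by (intro borel_closed)
  have "K \<noteq> {}" using Kpos by auto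
  let ?g = "\<lambda>j p. ennreal (exp (- real j * infdist p K))"
  have gm [measurable]: "?g j \<in> borel_measurable borel" for j
    by (intro measurable_compose[OF _ measurable_ennreal] borel_measurable_continuous_onI continuous_intros)
  have bd: "emeasure square_lborel A * emeasure square_lborel K \<le> ennreal (exp 30) * (\<integral>\<^sup>+p. indicator A p * ?g j p \<partial>square_lborel)" for j
  proof -
    have "emeasure square_lborel K = (\<integral>\<^sup>+p. indicator K p \<partial>square_lborel)" by simp
    also have "\<dots> \<le> (\<integral>\<^sup>+p. ?g j p \<partial>square_lborel)"
      by (intro nn_integral_mono) (auto simp: indicator_def)
    finally have "emeasure square_lborel A * emeasure square_lborel K \<le> emeasure square_lborel A * (\<integral>\<^sup>+p. ?g j p \<partial>square_lborel)"
      by (rule mult_left_mono) simp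
    also have "\<dots> \<le> ennreal (exp 30) * (\<integral>\<^sup>+p. indicator A p * ?g j p \<partial>square_lborel)"
      by (rule invariant_set_lower_bound[OF A gm inv log_lipschitz_exp_infdist]) simp_all
    finally show ?thesis .
  qed
  have "(\<lambda>j. \<integral>\<^sup>+p. indicator A p * ?g j p \<partial>square_lborel) \<longlonglongrightarrow> (\<integral>\<^sup>+p. 0 \<partial>square_lborel)"
  proof (rule nn_integral_dominated_convergence[where w="\<lambda>_. 1"])
    show "AE p in square_lborel. indicator A p * ?g j p \<le> 1" for j
      by (intro AE_I2) (auto simp: indicator_def infdist_nonneg)
    show "AE p in square_lborel. (\<lambda>j. indicator A p * ?g j p) \<longlonglongrightarrow> 0"
    proof (intro AE_I2)
      fix p show "(\<lambda>j. indicator A p * ?g j p) \<longlonglongrightarrow> 0"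
      proof (cases "p \<in> A")
        case True
        then have "p \<notin> K" using K by auto
        then have pos: "0 < infdist p K" using cl \<open>K \<noteq> {}\<close> infdist_pos_not_in_closed by blast
        have "(\<lambda>j. exp (- real j * infdist p K)) \<longlonglongrightarrow> 0" using pos by real_asymp
        then have "(\<lambda>j. ?g j p) \<longlonglongrightarrow> ennreal 0" by (rule tendsto_ennrealI)
        then show ?thesis using True by simp
      qed simp
    qed
    show "(\<lambda>p. indicator A p * ?g j p) \<in> borel_measurable square_lborel" for j
      using borel_measurable_times_ennreal[OF borel_measurable_indicator[OF A] gm[of j]]
      by (simp add: measurable_cong_sets[OF sets_square_lborel refl])
  qed (auto simp: emeasure_square_lborel_UNIV)
  then have "(\<lambda>j. ennreal (exp 30) * (\<integral>\<^sup>+p. indicator A p * ?g j p \<partial>square_lborel)) \<longlonglongrightarrow> ennreal (exp 30) * 0"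
    by (intro ennreal_tendsto_cmult) auto
  then have "emeasure square_lborel A * emeasure square_lborel K \<le> 0"
    using bd by (intro LIMSEQ_le_const) auto
  then show "emeasure square_lborel A = 0" using Kpos by simp
qed

section \<open>From the slow to the fast map\<close>

text \<open>
  A set of full measure that both maps preserve: no \<open>x\<close>-coordinate along the orbit is rational, so all
  partial quotients are defined and all inequalities between \<open>x\<close> and rational numbers are strict.
\<close>

definition generic :: "real \<times> real \<Rightarrow> bool" where
  "generic p \<longleftrightarrow> 0 < fst p \<and> fst p < 1 \<and> fst p \<notin> \<rat> \<and> 0 \<le> snd p \<and> snd p \<le> 1"

text \<open>
  The factors by which the two inverse maps contract the fibres; they are also the numbers to which
  the Gauss map is applied in a step.
\<close>

definition slow_ratio :: "real \<times> real \<Rightarrow> real" where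
  "slow_ratio p = (if green p then fst p else 1 - fst p)"

text \<open>
  The points in the upper strips, where the run of red steps at the beginning of a fast step is
  stopped by a green step; below them it is stopped by a red step.
\<close>

definition ends_green :: "real \<times> real \<Rightarrow> bool" where
  "ends_green p \<longleftrightarrow> 1 - snd p \<le> of_int \<lfloor>1 / fst p\<rfloor> * fst p"

definition fast_ratio :: "real \<times> real \<Rightarrow> real" where
  "fast_ratio p = (if ends_green p then fst p else fst p * gauss_map (fst p))"

text \<open>
  A closed form of \<open>N_F\<close>.
\<close>

definition red_run :: "real \<times> real \<Rightarrow> nat" where
  "red_run p = (if ends_green p then nat (\<lceil>(1 - snd p) / fst p\<rceil> - 1) else nat (\<lfloor>1 / fst p\<rfloor> - 1))"

lemma fast_map_red_run:
  "fast_map p = (if ends_green p then (gauss_map (fst p), (1 - snd p) / fst p - real (red_run p))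
     else (gauss_map (gauss_map (fst p)), snd p / fast_ratio p))"
  by (cases p) (simp add: fast_map_def ends_green_def red_run_def fast_ratio_def)

lemma irrational_one_minus:
  assumes "x \<notin> \<rat>"
  shows "1 - x \<notin> (\<rat>::real set)"
proof
  assume "1 - x \<in> \<rat>"
  from Rats_diff[OF Rats_1 this] have "1 - (1 - x) \<in> \<rat>" .
  then show False using assms by simp
qed

lemma generic_T_slow:
  assumes "generic p" shows "generic (T_slow p)"
proof -
  obtain x y where p: "p = (x, y)" by (cases p)
  have x: "0 < x" "x < 1" "x \<notin> \<rat>" "0 \<le> y" "y \<le> 1" using assms by (auto simp: generic_def p)
  have x': "0 < 1 - x" "1 - x < 1" "1 - x \<notin> \<rat>" using x irrational_one_minus by auto
  show ?thesis
    using x x' gauss_map_irrational[OF x(1-3)] gauss_map_irrational[OF x']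
    by (auto simp: p T_slow_def green_def generic_def divide_le_eq)
qed

lemma generic_funpow_T_slow: "generic p \<Longrightarrow> generic ((T_slow ^^ n) p)"
  by (induction n) (auto intro: generic_T_slow)

lemma slow_ratio_pos: "generic p \<Longrightarrow> 0 < slow_ratio p" "generic p \<Longrightarrow> slow_ratio p < 1"
  by (auto simp: slow_ratio_def generic_def)

context
  fixes x y :: real and m N :: nat
  assumes gen: "generic (x, y)"
  defines "m \<equiv> nat \<lfloor>1 / x\<rfloor>" and "N \<equiv> red_run (x, y)"
begin

lemma generic_coords: "0 < x" "x < 1" "x \<notin> \<rat>" "0 \<le> y" "y \<le> 1"
  using gen by (auto simp: generic_def)

lemma floor_inverse_eq: "real m = of_int \<lfloor>1 / x\<rfloor>" "1 \<le> m"
  using gauss_map_irrational(4)[OF generic_coords(1-3)] unfolding m_def by linarith+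

lemma floor_inverse_mult: "real m * x < 1" "1 < (real m + 1) * x" "x * gauss_map x = 1 - real m * x"
proof -
  note g = gauss_map_irrational[OF generic_coords(1-3)]
  show e: "x * gauss_map x = 1 - real m * x" using g floor_inverse_eq by simp
  show "real m * x < 1" using e mult_pos_pos[OF generic_coords(1) g(1)] by linarith
  have "x * gauss_map x < x * 1" using g generic_coords by (intro mult_strict_left_mono) auto
  then show "1 < (real m + 1) * x" using e by (simp add: algebra_simps)
qed

lemma ends_green_iff: "ends_green (x, y) \<longleftrightarrow> 1 - y \<le> real m * x"
  by (simp add: ends_green_def floor_inverse_eq)

lemma red_run_less: "N < m"
proof (cases "ends_green (x, y)")
  case True
  then have "(1 - y) / x \<le> real m" using generic_coords by (simp add: ends_green_iff divide_le_eq)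
  then have "\<lceil>(1 - y) / x\<rceil> \<le> int m" by (simp add: ceiling_le_iff)
  then show ?thesis using True floor_inverse_eq(2) by (simp add: N_def red_run_def)
next
  case False
  then have "N = nat (\<lfloor>1 / x\<rfloor> - 1)" by (simp add: N_def red_run_def)
  then show ?thesis using floor_inverse_eq(2) unfolding m_def by linarith
qed

lemma red_run_upper: "ends_green (x, y) \<Longrightarrow> 1 - y \<le> (real N + 1) * x"
proof -
  assume u: "ends_green (x, y)"
  have "(1 - y) / x \<le> real N + 1" unfolding N_def red_run_def using u by simp linarith
  then show ?thesis using generic_coords by (simp add: divide_le_eq)
qed

lemma red_run_lower: "\<not> ends_green (x, y) \<Longrightarrow> Suc N = m"
proof -
  assume "\<not> ends_green (x, y)"
  then have "N = nat (\<lfloor>1 / x\<rfloor> - 1)" by (simp add: N_def red_run_def)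
  then show ?thesis using floor_inverse_eq(2) unfolding m_def by linarith
qed

lemma before_red_run:
  assumes "j < N"
  shows "(real j + 1) * x < 1 - y" "(real j + 2) * x < 1"
proof -
  have "(real j + 2) * x \<le> real m * x" using assms red_run_less generic_coords by (intro mult_right_mono) auto
  then show "(real j + 2) * x < 1" using floor_inverse_mult(1) by linarith
  show "(real j + 1) * x < 1 - y"
  proof (cases "ends_green (x, y)")
    case True
    then have "real j + 1 < (1 - y) / x" using assms unfolding N_def red_run_def by simp linarith
    then show ?thesis using generic_coords by (simp add: less_divide_eq)
  next
    case False
    have "(real j + 1) * x \<le> real m * x" using assms red_run_less generic_coords by (intro mult_right_mono) auto
    then show ?thesis using False by (simp add: ends_green_iff)
  qed
qed

lemma denom_pos: "j \<le> N \<Longrightarrow> 0 < 1 - real j * x"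
proof -
  assume "j \<le> N"
  then have "real j * x \<le> real m * x" using red_run_less generic_coords by (intro mult_right_mono) auto
  then show ?thesis using floor_inverse_mult(1) by linarith
qed

lemma green_scaled:
  assumes "0 < 1 - real j * x"
  shows "green (x / (1 - real j * x), y / (1 - real j * x)) \<longleftrightarrow> 1 - y \<le> (real j + 1) * x"
proof -
  have "green (x / (1 - real j * x), y / (1 - real j * x)) \<longleftrightarrow> 1 \<le> (x + y) / (1 - real j * x)"
    by (auto simp: green_def add_divide_distrib)
  also have "\<dots> \<longleftrightarrow> 1 - real j * x \<le> x + y" using assms by simp
  finally show ?thesis by (auto simp: algebra_simps)
qed

lemma one_minus_scaled:
  assumes "0 < 1 - real j * x"
  shows "1 - x / (1 - real j * x) = (1 - (real j + 1) * x) / (1 - real j * x)"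
  using assms by (simp add: field_simps)

text \<open>
  While \<open>N_F\<close> counts, all steps are red with partial quotient 1, that is \<open>x \<mapsto> x / (1 - x)\<close>. The
  product of the fibre factors telescopes.
\<close>

lemma T_slow_iterate:
  "j \<le> N \<Longrightarrow> (T_slow ^^ j) (x, y) = (x / (1 - real j * x), y / (1 - real j * x)) \<and>
      (\<Prod>i<j. slow_ratio ((T_slow ^^ i) (x, y))) = 1 - real j * x"
proof (induction j)
  case (Suc j)
  let ?d = "1 - real j * x" and ?d' = "1 - (real j + 1) * x"
  have j: "j < N" using Suc by simp
  have d: "0 < ?d" "0 < ?d'" using denom_pos[of j] denom_pos[of "Suc j"] Suc by (auto simp: add.commute)
  have red: "\<not> green (x / ?d, y / ?d)" using green_scaled[OF d(1)] before_red_run(1)[OF j] by simp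
  have "1 / (1 - x / ?d) = 1 + x / ?d'"
  proof -
    have "1 / (1 - x / ?d) = ?d / ?d'" using d by (simp add: one_minus_scaled)
    also have "\<dots> = (?d' + x) / ?d'" by (simp add: algebra_simps)
    finally show ?thesis using d by (simp add: add_divide_distrib)
  qed
  moreover have "x / ?d' < 1" using before_red_run(2)[OF j] d by (simp add: divide_less_eq algebra_simps)
  moreover have "0 < x / ?d'" using d generic_coords by simp
  ultimately have "gauss_map (1 - x / ?d) = x / ?d'"
    unfolding gauss_map_def by (simp add: floor_eq_iff)
  moreover have "y / ?d / (1 - x / ?d) = y / ?d'" using d by (simp add: one_minus_scaled)
  ultimately have step: "T_slow (x / ?d, y / ?d) = (x / ?d', y / ?d')"
    using red by (simp add: T_slow_def)
  have IH: "(T_slow ^^ j) (x, y) = (x / ?d, y / ?d)" "(\<Prod>i<j. slow_ratio ((T_slow ^^ i) (x, y))) = ?d"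
    using Suc by auto
  have "(\<Prod>i<Suc j. slow_ratio ((T_slow ^^ i) (x, y))) = ?d * (1 - x / ?d)"
    using IH red by (simp add: slow_ratio_def)
  also have "\<dots> = ?d'" using d by (simp add: one_minus_scaled)
  finally show ?case using IH step by (simp add: add.commute)
qed simp

lemma T_slow_red_run_mem_F: "(T_slow ^^ N) (x, y) \<in> F_set"
proof -
  have d: "0 < 1 - real N * x" by (rule denom_pos) simp
  show ?thesis
  proof (cases "ends_green (x, y)")
    case True
    then have "green ((T_slow ^^ N) (x, y))" using red_run_upper green_scaled[OF d] T_slow_iterate[of N] by simp
    then show ?thesis by (auto simp: green_def F_set_def)
  next
    case False
    then have m: "real m = real N + 1" using red_run_lower by simp
    have "x / (1 - real N * x) > 1 / 2" using floor_inverse_mult(2) d unfolding m by (simp add: less_divide_eq algebra_simps)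
    then show ?thesis using T_slow_iterate[of N] by (simp add: F_set_def)
  qed
qed

lemma T_slow_before_red_run_notin_F:
  assumes "j < N" shows "(T_slow ^^ j) (x, y) \<notin> F_set"
proof -
  have d: "0 < 1 - real j * x" using assms by (intro denom_pos) simp
  have "\<not> green (x / (1 - real j * x), y / (1 - real j * x))"
    using green_scaled[OF d] before_red_run(1)[OF assms] by simp
  moreover have "\<not> x / (1 - real j * x) > 1 / 2"
    using before_red_run(2)[OF assms] d by (simp add: less_divide_eq algebra_simps)
  ultimately show ?thesis using T_slow_iterate[of j] assms by (simp add: F_set_def green_def)
qed

lemma N_F_eq_red_run: "N_F (x, y) = N"
  unfolding N_F_def
  using T_slow_red_run_mem_F T_slow_before_red_run_notin_F not_le by (intro Least_equality) blast+

lemma T_slow_after_red_run: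
  "T_slow ((T_slow ^^ N) (x, y)) = fast_map (x, y)"
  "(\<Prod>i<Suc N. slow_ratio ((T_slow ^^ i) (x, y))) = fast_ratio (x, y)"
proof -
  let ?d = "1 - real N * x"
  have d: "0 < ?d" by (rule denom_pos) simp
  have it: "(T_slow ^^ N) (x, y) = (x / ?d, y / ?d)" "(\<Prod>i<N. slow_ratio ((T_slow ^^ i) (x, y))) = ?d"
    using T_slow_iterate[of N] by auto
  have "T_slow ((T_slow ^^ N) (x, y)) = fast_map (x, y) \<and>
    (\<Prod>i<Suc N. slow_ratio ((T_slow ^^ i) (x, y))) = fast_ratio (x, y)"
  proof (cases "ends_green (x, y)")
    case True
    then have gr: "green (x / ?d, y / ?d)" using red_run_upper green_scaled[OF d] by simp
    have "1 / (x / ?d) = 1 / x - of_int (int N)" using generic_coords by (simp add: field_simps)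
    then have "gauss_map (x / ?d) = gauss_map x" unfolding gauss_map_def by (simp only: floor_diff_of_int)
    moreover have "(1 - y / ?d) / (x / ?d) = (1 - y) / x - real N" using generic_coords d by (simp add: field_simps)
    ultimately have "T_slow (x / ?d, y / ?d) = fast_map (x, y)"
      using gr True by (simp add: T_slow_def fast_map_red_run N_def)
    then show ?thesis using it gr d True by (simp add: slow_ratio_def fast_ratio_def)
  next
    case False
    then have m: "real m = real N + 1" using red_run_lower by simp
    have red: "\<not> green (x / ?d, y / ?d)" using False green_scaled[OF d] unfolding ends_green_iff m by simp
    have r: "1 - x / ?d = x * gauss_map x / ?d" using d floor_inverse_mult(3) m by (simp add: one_minus_scaled)
    note g = gauss_map_irrational[OF generic_coords(1-3)]
    have "1 / (1 - x / ?d) = 1 / gauss_map x + 1"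
    proof -
      have "?d = x * gauss_map x + x" using floor_inverse_mult(3) m by (simp add: algebra_simps)
      then have "1 / (1 - x / ?d) = (x * gauss_map x + x) / (x * gauss_map x)" unfolding r by simp
      also have "\<dots> = 1 / gauss_map x + 1" using generic_coords(1) g(1) by (simp add: add_divide_distrib)
      finally show ?thesis .
    qed
    then have "gauss_map (1 - x / ?d) = gauss_map (gauss_map x)"
      unfolding gauss_map_def[of "1 - x / ?d"] gauss_map_def[of "gauss_map x"] by simp
    moreover have "y / ?d / (1 - x / ?d) = y / (x * gauss_map x)" unfolding r using d by simp
    ultimately have "T_slow (x / ?d, y / ?d) = fast_map (x, y)"
      using red False by (simp add: T_slow_def fast_map_red_run fast_ratio_def)
    then show ?thesis using it red d False r by (simp add: slow_ratio_def fast_ratio_def)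
  qed
  then show "T_slow ((T_slow ^^ N) (x, y)) = fast_map (x, y)"
    "(\<Prod>i<Suc N. slow_ratio ((T_slow ^^ i) (x, y))) = fast_ratio (x, y)" by auto
qed

end

lemma generic_fast_step:
  assumes "generic p"
  shows "N_F p = red_run p" "T_fast p = fast_map p" "generic (fast_map p)" "(T_slow ^^ red_run p) p \<in> F_set"
    "(\<Prod>i<Suc (red_run p). slow_ratio ((T_slow ^^ i) p)) = fast_ratio p"
proof -
  obtain x y where p: "p = (x, y)" by (cases p)
  have g: "generic (x, y)" using assms p by simp
  show N: "N_F p = red_run p" unfolding p by (rule N_F_eq_red_run[OF g])
  show F: "T_fast p = fast_map p" using T_slow_after_red_run(1)[OF g] by (simp add: T_fast_def N p[symmetric])
  show "generic (fast_map p)" unfolding F[symmetric] T_fast_def using generic_funpow_T_slow[OF assms] by blast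
  show "(T_slow ^^ red_run p) p \<in> F_set" unfolding p by (rule T_slow_red_run_mem_F[OF g])
  show "(\<Prod>i<Suc (red_run p). slow_ratio ((T_slow ^^ i) p)) = fast_ratio p"
    unfolding p by (rule T_slow_after_red_run(2)[OF g])
qed

text \<open>
  In terms of logarithms, \<open>- ln x \<le> - ln fast_ratio \<le> - ln x - ln y\<close>: the first inequality makes the
  mean large, the second makes it finite. For the second, where \<open>y > 0\<close>, if a fast step ends with a red step, \<open>(x, y)\<close>
  lies in the part of the fibre below \<open>1 - m * x\<close>, which is the ratio of that step.
\<close>

lemma fast_ratio_bounds:
  assumes "generic p"
  shows "0 < fast_ratio p" "fast_ratio p < 1" "fast_ratio p \<le> fst p" "fst p * snd p \<le> fast_ratio p"
proof -
  obtain x y where p: "p = (x, y)" by (cases p)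
  have x: "0 < x" "x < 1" "x \<notin> \<rat>" "0 \<le> y" "y \<le> 1" using assms by (auto simp: generic_def p)
  note g = gauss_map_irrational[OF x(1-3)]
  have le: "x * gauss_map x \<le> x * 1" "x * y \<le> x * 1" "x * y \<le> 1 * y" using g x by (intro mult_left_mono mult_right_mono; simp)+
  have pos: "0 < x * gauss_map x" using x g(1) by simp
  show "0 < fast_ratio p" using x(1) pos by (simp add: p fast_ratio_def)
  show 1: "fast_ratio p \<le> fst p" using le by (auto simp: p fast_ratio_def)
  then show "fast_ratio p < 1" using x by (simp add: p)
  show "fst p * snd p \<le> fast_ratio p"
    using le g(5) by (auto simp: p fast_ratio_def ends_green_def)
qed

lemma generic_funpow_fast_map: "generic p \<Longrightarrow> generic ((fast_map ^^ k) p)"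
  by (induction k) (auto intro: generic_fast_step)

lemma T_fast_orbit:
  assumes p: "generic p"
  shows "(T_fast ^^ k) p = (fast_map ^^ k) p" "(T_slow ^^ nidx p k) p = (fast_map ^^ k) p"
    "nidx p k = (\<Sum>j<k. red_run ((fast_map ^^ j) p) + 1)"
    "(\<Prod>i<nidx p k. slow_ratio ((T_slow ^^ i) p)) = (\<Prod>j<k. fast_ratio ((fast_map ^^ j) p))"
proof -
  have "(T_fast ^^ k) p = (fast_map ^^ k) p \<and> (T_slow ^^ nidx p k) p = (fast_map ^^ k) p \<and>
    nidx p k = (\<Sum>j<k. red_run ((fast_map ^^ j) p) + 1) \<and>
    (\<Prod>i<nidx p k. slow_ratio ((T_slow ^^ i) p)) = (\<Prod>j<k. fast_ratio ((fast_map ^^ j) p))"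
  proof (induction k)
    case (Suc k)
    let ?r = "(fast_map ^^ k) p"
    have gr: "generic ?r" by (rule generic_funpow_fast_map[OF p])
    note st = generic_fast_step[OF gr]
    have IH: "(T_fast ^^ k) p = ?r" "(T_slow ^^ nidx p k) p = ?r" "nidx p k = (\<Sum>j<k. red_run ((fast_map ^^ j) p) + 1)"
      "(\<Prod>i<nidx p k. slow_ratio ((T_slow ^^ i) p)) = (\<Prod>j<k. fast_ratio ((fast_map ^^ j) p))"
      using Suc by blast+
    have nS: "nidx p (Suc k) = Suc (red_run ?r) + nidx p k" using IH(1) st(1) by simp
    have T: "(T_slow ^^ (j + nidx p k)) p = (T_slow ^^ j) ?r" for j
      by (simp add: funpow_add IH(2))
    have it: "(T_slow ^^ nidx p (Suc k)) p = fast_map ?r"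
      unfolding nS T using st(1,2) by (simp add: T_fast_def)
    have pr: "(\<Prod>i<nidx p (Suc k). slow_ratio ((T_slow ^^ i) p)) =
        (\<Prod>i<nidx p k. slow_ratio ((T_slow ^^ i) p)) * (\<Prod>i<Suc (red_run ?r). slow_ratio ((T_slow ^^ i) ?r))"
    proof -
      have "{..<nidx p (Suc k)} = {..<nidx p k} \<union> {nidx p k..<nidx p (Suc k)}" using nS by auto
      moreover have "(\<Prod>i=nidx p k..<nidx p (Suc k). slow_ratio ((T_slow ^^ i) p)) =
          (\<Prod>i=0..<Suc (red_run ?r). slow_ratio ((T_slow ^^ (i + nidx p k)) p))"
        unfolding nS using prod.shift_bounds_nat_ivl[of "\<lambda>i. slow_ratio ((T_slow ^^ i) p)" 0 "nidx p k" "Suc (red_run ?r)"] by simp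
      ultimately show ?thesis unfolding T
        by (subst \<open>{..<nidx p (Suc k)} = _\<close>, subst prod.union_disjoint) (auto simp: lessThan_atLeast0)
    qed
    show ?case
    proof (intro conjI)
      show "(T_fast ^^ Suc k) p = (fast_map ^^ Suc k) p" by (simp add: IH(1) st(2))
      show "(T_slow ^^ nidx p (Suc k)) p = (fast_map ^^ Suc k) p" by (simp add: it del: nidx.simps)
      show "nidx p (Suc k) = (\<Sum>j<Suc k. red_run ((fast_map ^^ j) p) + 1)" using nS IH(3) by simp
      show "(\<Prod>i<nidx p (Suc k). slow_ratio ((T_slow ^^ i) p)) = (\<Prod>j<Suc k. fast_ratio ((fast_map ^^ j) p))"
        unfolding pr IH(4) st(5) by simp
    qed
  qed simp
  then show "(T_fast ^^ k) p = (fast_map ^^ k) p" "(T_slow ^^ nidx p k) p = (fast_map ^^ k) p"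
    "nidx p k = (\<Sum>j<k. red_run ((fast_map ^^ j) p) + 1)"
    "(\<Prod>i<nidx p k. slow_ratio ((T_slow ^^ i) p)) = (\<Prod>j<k. fast_ratio ((fast_map ^^ j) p))"
    by auto
qed

section \<open>Denominators\<close>

text \<open>
  Let \<open>c = q_shift p n\<close> and \<open>d = d_coeff p n\<close>. Then \<open>x\<close> is a Moebius transform of \<open>x\<^sub>n\<close> with denominator
  \<open>c * x\<^sub>n + d\<close>, while the convergent arises by replacing \<open>x\<^sub>n\<close> by 0 (next step green) or 1 (next step red),
  because the digit absorbs the 1 in \<open>x\<^sub>n = 1 - 1 / \<dots>\<close>. This is why \<open>q\<^sub>n\<close> equals \<open>d\<close> or \<open>c + d\<close>, and why the pair
  \<open>(c, d)\<close> is easier to control than successive denominators: its recursion has nonnegative coefficients.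
\<close>

definition red_step :: "real \<times> real \<Rightarrow> nat \<Rightarrow> int" where
  "red_step p n = (if green ((T_slow ^^ n) p) then 0 else 1)"

definition d_coeff :: "real \<times> real \<Rightarrow> nat \<Rightarrow> int" where
  "d_coeff p n = q_shift p (Suc n) - red_step p n * q_shift p n"

lemma d_coeff_Suc: "d_coeff p (Suc n) = ahat p (Suc n) * q_shift p (Suc n) + eps p n * q_shift p n"
  by (simp add: d_coeff_def dig_def red_step_def eps_def algebra_simps del: ahat.simps)

lemma ahat_generic:
  assumes "generic p"
  shows "1 \<le> ahat p (Suc n)"
    "1 / slow_ratio ((T_slow ^^ n) p) = ahat p (Suc n) + xseq p (Suc n)"
    "(T_slow ^^ n) p \<in> F_set \<Longrightarrow> \<not> green ((T_slow ^^ n) p) \<Longrightarrow> 2 \<le> ahat p (Suc n)"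
proof -
  let ?r = "(T_slow ^^ n) p"
  have g: "generic ?r" by (rule generic_funpow_T_slow[OF assms])
  obtain x y where r: "?r = (x, y)" by (cases ?r)
  have a: "ahat p (Suc n) = \<lfloor>1 / slow_ratio ?r\<rfloor>" by (simp add: slow_ratio_def xseq_def)
  have "1 \<le> 1 / slow_ratio ?r" using slow_ratio_pos[OF g] by simp
  then show "1 \<le> ahat p (Suc n)" unfolding a by linarith
  have "xseq p (Suc n) = fst (T_slow (x, y))" by (simp add: xseq_def r)
  also have "\<dots> = gauss_map (slow_ratio ?r)" unfolding r by (simp add: T_slow_def slow_ratio_def)
  finally show "1 / slow_ratio ?r = ahat p (Suc n) + xseq p (Suc n)" unfolding a by (simp add: gauss_map_def)
  assume "?r \<in> F_set" "\<not> green ?r"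
  then have "x > 1 / 2" by (auto simp: r F_set_def green_def)
  then have "2 \<le> 1 / (1 - x)" using g by (simp add: generic_def r le_divide_eq)
  then show "2 \<le> ahat p (Suc n)" unfolding a using \<open>\<not> green ?r\<close> by (simp add: slow_ratio_def r le_floor_iff)
qed

lemma q_shift_d_coeff_step:
  "q_shift p (Suc n) = d_coeff p n + red_step p n * q_shift p n"
  "d_coeff p (Suc n) = (if green ((T_slow ^^ n) p) then ahat p (Suc n) * d_coeff p n + q_shift p n
     else (ahat p (Suc n) - 1) * q_shift p n + ahat p (Suc n) * d_coeff p n)"
proof -
  show 1: "q_shift p (Suc n) = d_coeff p n + red_step p n * q_shift p n" by (simp add: d_coeff_def)
  show "d_coeff p (Suc n) = (if green ((T_slow ^^ n) p) then ahat p (Suc n) * d_coeff p n + q_shift p n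
     else (ahat p (Suc n) - 1) * q_shift p n + ahat p (Suc n) * d_coeff p n)"
    unfolding d_coeff_Suc 1 by (simp add: red_step_def eps_def algebra_simps del: ahat.simps)
qed

lemma coeffs_nonneg:
  assumes "generic p"
  shows "0 \<le> q_shift p n" "0 \<le> d_coeff p n"
proof -
  have "0 \<le> q_shift p n \<and> 0 \<le> d_coeff p n"
  proof (induction n)
    case 0 then show ?case by (simp add: d_coeff_def)
  next
    case (Suc n)
    then show ?case using ahat_generic(1)[OF assms, of n]
      by (auto simp: q_shift_d_coeff_step red_step_def simp del: ahat.simps q_shift.simps)
  qed
  then show "0 \<le> q_shift p n" "0 \<le> d_coeff p n" by auto
qed

text \<open>
  Both factors of the product transform by \<open>slow_ratio\<close> in opposite directions, since
  \<open>1 / slow_ratio\<close> is the next partial quotient plus \<open>x\<^sub>n\<^sub>+\<^sub>1\<close>.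
\<close>

lemma prod_slow_ratio_denominator:
  assumes "generic p"
  shows "(\<Prod>i<n. slow_ratio ((T_slow ^^ i) p)) * (q_shift p n * xseq p n + d_coeff p n) = 1"
proof (induction n)
  case 0 then show ?case by (simp add: d_coeff_def)
next
  case (Suc n)
  let ?r = "slow_ratio ((T_slow ^^ n) p)"
  have r: "0 < ?r" by (rule slow_ratio_pos(1)[OF generic_funpow_T_slow[OF assms]])
  have "?r * (q_shift p (Suc n) * xseq p (Suc n) + d_coeff p (Suc n)) =
      ?r * (q_shift p (Suc n) * (1 / ?r) + eps p n * q_shift p n)"
    unfolding ahat_generic(2)[OF assms] d_coeff_Suc by (simp add: algebra_simps del: ahat.simps q_shift.simps)
  also have "\<dots> = q_shift p (Suc n) + ?r * eps p n * q_shift p n" using r by (simp add: distrib_left)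
  also have "\<dots> = q_shift p n * xseq p n + d_coeff p n"
    unfolding q_shift_d_coeff_step(1)[of p n] by (simp add: red_step_def eps_def slow_ratio_def xseq_def algebra_simps)
  finally show ?case using Suc by (simp add: mult.assoc del: q_shift.simps)
qed

text \<open>
  This can fail after a red step with partial quotient 1, where \<open>c\<close> grows to \<open>c + d\<close> and \<open>d\<close> stays the same; such
  steps are exactly those that the acceleration skips.
\<close>

lemma coeffs_ordered_after_F:
  assumes p: "generic p" and F: "(T_slow ^^ n) p \<in> F_set"
  shows "q_shift p (Suc n) \<le> d_coeff p (Suc n)"
proof (cases "green ((T_slow ^^ n) p)")
  case True
  have "1 * d_coeff p n \<le> ahat p (Suc n) * d_coeff p n"
    by (intro mult_right_mono ahat_generic(1)[OF p] coeffs_nonneg[OF p])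
  then show ?thesis using True coeffs_nonneg[OF p, of n]
    by (simp add: q_shift_d_coeff_step red_step_def del: ahat.simps q_shift.simps)
next
  case False
  have a: "2 \<le> ahat p (Suc n)" by (rule ahat_generic(3)[OF p F False])
  have "1 * q_shift p n \<le> (ahat p (Suc n) - 1) * q_shift p n" "1 * d_coeff p n \<le> ahat p (Suc n) * d_coeff p n"
    using a by (intro mult_right_mono coeffs_nonneg[OF p]; simp)+
  then show ?thesis using False
    by (simp add: q_shift_d_coeff_step red_step_def del: ahat.simps q_shift.simps)
qed

lemma coeffs_ordered_nidx:
  assumes p: "generic p"
  shows "q_shift p (nidx p k) \<le> d_coeff p (nidx p k)"
proof (cases k)
  case 0 then show ?thesis by (simp add: d_coeff_def)
next
  case (Suc j)
  let ?r = "(fast_map ^^ j) p"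
  have gr: "generic ?r" by (rule generic_funpow_fast_map[OF p])
  have "(T_slow ^^ (red_run ?r + nidx p j)) p = (T_slow ^^ red_run ?r) ?r"
    using T_fast_orbit(2)[OF p] by (simp add: funpow_add)
  then have "(T_slow ^^ (red_run ?r + nidx p j)) p \<in> F_set" using generic_fast_step(4)[OF gr] by simp
  from coeffs_ordered_after_F[OF p this] show ?thesis
    using generic_fast_step(1)[OF gr] T_fast_orbit(1)[OF p] by (simp add: Suc add.commute)
qed

text \<open>
  At fast times \<open>c \<le> d\<close>, so that the denominator of the convergent and the number \<open>c * x\<^sub>n + d\<close> both lie
  between \<open>d\<close> and \<open>2 * d\<close>. The latter is the inverse product of the fibre factors, which makes
  \<open>ln qbar\<close> a Birkhoff sum up to a bounded error.
\<close>

lemma ln_qbar_approx: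
  assumes p: "generic p"
  shows "0 < qbar p k" "\<bar>ln (real_of_int (qbar p k)) - (\<Sum>j<k. - ln (fast_ratio ((fast_map ^^ j) p)))\<bar> \<le> ln 2"
proof -
  define n where "n = nidx p k"
  define c where "c = real_of_int (q_shift p n)"
  define d where "d = real_of_int (d_coeff p n)"
  define x where "x = xseq p n"
  define Q where "Q = real_of_int (qbar p k)"
  define R where "R = (\<Prod>j<k. fast_ratio ((fast_map ^^ j) p))"
  have c: "0 \<le> c" "c \<le> d" using coeffs_nonneg[OF p] coeffs_ordered_nidx[OF p] by (simp_all add: c_def d_def n_def)
  have x: "0 < x" "x < 1" using generic_funpow_T_slow[OF p, of n] by (simp_all add: x_def xseq_def generic_def)
  have Rpos: "0 < R" unfolding R_def by (intro prod_pos fast_ratio_bounds generic_funpow_fast_map p)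
  have id: "R * (c * x + d) = 1"
    using prod_slow_ratio_denominator[OF p, of n] T_fast_orbit(4)[OF p, of k] by (simp add: R_def c_def d_def x_def n_def)
  have cx: "0 \<le> c * x" "c * x \<le> c * 1" using c x mult_left_mono[of x 1 c] by simp_all
  have D: "c * x + d = 1 / R" using id Rpos by (simp add: field_simps)
  then have Dpos: "0 < c * x + d" using Rpos by simp
  have dpos: "0 < d" using Dpos cx c by linarith
  have Qd: "d \<le> Q" "Q \<le> 2 * d"
    using c unfolding Q_def qbar_def q_def n_def[symmetric] q_shift_d_coeff_step(1) by (auto simp: red_step_def c_def d_def)
  then have Qpos: "0 < Q" using dpos by linarith
  then show "0 < qbar p k" by (simp add: Q_def)
  have "Q \<le> 2 * (e + d)" "e + d \<le> 2 * Q" if "0 \<le> e" "e \<le> c" for e using Qd c that by simp_all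
  from this[of "c * x"] have "Q \<le> 2 * (c * x + d)" "c * x + d \<le> 2 * Q" using cx by simp_all
  moreover have "ln a \<le> ln 2 + ln b" if "a \<le> 2 * b" "0 < a" "0 < b" for a b :: real
    using that ln_le_cancel_iff[of a "2 * b"] by (simp add: ln_mult)
  ultimately have "ln Q \<le> ln 2 + ln (c * x + d)" "ln (c * x + d) \<le> ln 2 + ln Q"
    using Qpos Dpos by blast+
  then have "\<bar>ln Q - ln (c * x + d)\<bar> \<le> ln 2" by linarith
  moreover have "ln (c * x + d) = - ln R" using Rpos by (simp add: D ln_div)
  moreover have "ln R = (\<Sum>j<k. ln (fast_ratio ((fast_map ^^ j) p)))"
  proof -
    have "0 < fast_ratio ((fast_map ^^ j) p)" for j by (intro fast_ratio_bounds generic_funpow_fast_map p)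
    then show ?thesis unfolding R_def by (intro ln_prod) (simp, metis less_irrefl)
  qed
  ultimately show "\<bar>ln (real_of_int (qbar p k)) - (\<Sum>j<k. - ln (fast_ratio ((fast_map ^^ j) p)))\<bar> \<le> ln 2"
    by (simp add: Q_def sum_negf)
qed

lemma q_nonneg: "generic p \<Longrightarrow> 0 \<le> q p n"
  unfolding q_def by (rule coeffs_nonneg)

section \<open>Integrals\<close>

lemma AE_generic: "AE p in square_lborel. generic p"
  using AE_square_lborel by eventually_elim (simp add: generic_def)

text \<open>
  Measurability on the plane is easier to prove for the product of the Borel algebras, where
  \<open>fst\<close> and \<open>snd\<close> are known to be measurable.
\<close>

lemma measurable_of_pair: "f \<in> borel_measurable (borel \<Otimes>\<^sub>M borel) \<Longrightarrow> f \<in> borel_measurable (borel :: (real \<times> real) measure)"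
  by (simp add: borel_prod)

lemma borel_measurable_fast_ratio [measurable]: "fast_ratio \<in> borel_measurable borel"
  by (rule measurable_of_pair) (unfold fast_ratio_def[abs_def] ends_green_def, measurable)

lemma borel_measurable_red_run [measurable]: "(\<lambda>p. real (red_run p)) \<in> borel_measurable borel"
  by (rule measurable_of_pair) (unfold red_run_def ends_green_def if_distrib[of real], measurable)

lemma nn_integral_neg_ln: "(\<integral>\<^sup>+x. ennreal (- ln x) \<partial>unit_lborel) = 1"
proof -
  have lim: "((\<lambda>x::real. x - x * ln x) \<longlongrightarrow> 0) (at_right 0)" "((\<lambda>x::real. x - x * ln x) \<longlongrightarrow> 1) (at_left 1)"
    by real_asymp+
  have FTC: "set_integrable lborel (einterval 0 1) (\<lambda>x::real. - ln x)" "(LBINT x=0..1. - ln x) = 1 - 0"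
    by (rule interval_integral_FTC_nonneg[where F="\<lambda>x. x - x * ln x"];
        (insert lim, auto intro!: derivative_eq_intros continuous_intros simp: zero_ereal_def one_ereal_def ereal_tendsto_simps1))+
  have ei: "einterval 0 1 = {0<..<1::real}" by (auto simp: einterval_def zero_ereal_def one_ereal_def)
  have int: "integrable lborel (\<lambda>x::real. indicator {0<..<1} x *\<^sub>R - ln x)"
    using FTC(1) unfolding set_integrable_def ei .
  have "(\<integral>\<^sup>+x. ennreal (- ln x) \<partial>unit_lborel) = (\<integral>\<^sup>+x. ennreal (- ln x) * indicator {0..1} x \<partial>lborel)"
    by (rule nn_integral_unit_lborel) measurable
  also have "\<dots> = (\<integral>\<^sup>+x. ennreal (indicator {0<..<1} x *\<^sub>R - ln (x::real)) \<partial>lborel)"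
    using AE_lborel_singleton[of "0::real"] AE_lborel_singleton[of "1::real"]
    by (intro nn_integral_cong_AE) (eventually_elim, auto simp: indicator_def)
  also have "\<dots> = ennreal (\<integral>x. indicator {0<..<1} x *\<^sub>R - ln (x::real) \<partial>lborel)"
    by (intro nn_integral_eq_integral int) (auto simp: indicator_def)
  also have "(\<integral>x. indicator {0<..<1} x *\<^sub>R - ln (x::real) \<partial>lborel) = 1"
    using FTC(2) by (simp add: interval_lebesgue_integral_def set_lebesgue_integral_def ei)
  finally show ?thesis by simp
qed

text \<open>
  Splitting the integral along the branches of the Gauss map produces the harmonic series.
\<close>

lemma nn_integral_inverse_top: "(\<integral>\<^sup>+x. ennreal (1 / x) \<partial>unit_lborel) = \<infinity>"
proof -
  have eq: "1 / real (Suc (Suc m)) = inverse (real (m + 2))" for m by (simp add: inverse_eq_divide)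
  have ns: "\<not> summable (\<lambda>m. 1 / real (Suc (Suc m)))"
    unfolding eq by (subst summable_iff_shift[of "\<lambda>m. inverse (real m)"]) (rule not_summable_harmonic)
  have top: "(\<Sum>m. ennreal (1 / real (Suc (Suc m)))) = top"
  proof (rule ccontr)
    assume "(\<Sum>m. ennreal (1 / real (Suc (Suc m)))) \<noteq> top"
    then have "summable (\<lambda>m. 1 / real (Suc (Suc m)))" by (rule summable_suminf_not_top[rotated]) simp
    with ns show False by (rule notE)
  qed
  have "(\<integral>\<^sup>+x. ennreal (1 / x) \<partial>unit_lborel) =
     (\<integral>\<^sup>+t. (\<Sum>m. ennreal (1 / (real (Suc m) + t)^2) * ennreal (1 / (1 / (real (Suc m) + t)))) \<partial>unit_lborel)"
    by (rule nn_integral_unit_lborel_gauss_branches) measurable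
  also have "\<dots> \<ge> (\<integral>\<^sup>+t. \<infinity> \<partial>unit_lborel)"
  proof (intro nn_integral_mono_AE, use AE_unit_lborel_irrational in eventually_elim)
    case (elim t)
    have "(\<Sum>m. ennreal (1 / real (Suc (Suc m)))) \<le> (\<Sum>m. ennreal (1 / (real (Suc m) + t)^2) * ennreal (1 / (1 / (real (Suc m) + t))))"
    proof (intro suminf_le)
      fix m
      have w: "0 < real (Suc m) + t" using elim by simp
      have "1 / real (Suc (Suc m)) \<le> 1 / (real (Suc m) + t)" using elim by (intro divide_left_mono) auto
      also have "\<dots> = 1 / (real (Suc m) + t)^2 * (1 / (1 / (real (Suc m) + t)))" using w by (simp add: power2_eq_square)
      finally show "ennreal (1 / real (Suc (Suc m))) \<le> ennreal (1 / (real (Suc m) + t)^2) * ennreal (1 / (1 / (real (Suc m) + t)))"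
        using w by (subst ennreal_mult'[symmetric]) (auto intro: ennreal_leI)
    qed auto
    then show ?case using top by simp
  qed
  finally show ?thesis by (simp add: emeasure_unit_lborel_UNIV top_unique)
qed

lemma nn_integral_fst_square_lborel:
  assumes [measurable]: "f \<in> borel_measurable borel"
  shows "(\<integral>\<^sup>+p. f (fst p) \<partial>square_lborel) = (\<integral>\<^sup>+x. f x \<partial>unit_lborel)"
proof -
  have "(\<lambda>p::real \<times> real. f (fst p)) \<in> borel_measurable borel" by (rule measurable_of_pair) measurable
  then show ?thesis by (subst nn_integral_square_lborel) (simp_all add: emeasure_unit_lborel_UNIV)
qed

lemma has_bochner_integral_neg_ln_fst: "has_bochner_integral square_lborel (\<lambda>p. - ln (fst p)) 1"
proof (rule has_bochner_integral_nn_integral)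
  have "(\<lambda>p::real \<times> real. - ln (fst p)) \<in> borel_measurable borel" by (rule measurable_of_pair) measurable
  then show "(\<lambda>p. - ln (fst p)) \<in> borel_measurable square_lborel"
    by (simp add: measurable_cong_sets[OF sets_square_lborel refl])
  show "AE p in square_lborel. 0 \<le> - ln (fst p)" using AE_square_lborel by eventually_elim simp
  show "(\<integral>\<^sup>+p. ennreal (- ln (fst p)) \<partial>square_lborel) = ennreal 1"
    by (subst nn_integral_fst_square_lborel[of "\<lambda>x. ennreal (- ln x)"]) (simp_all add: nn_integral_neg_ln)
qed simp

text \<open>
  The logarithm is dominated by \<open>- ln x - ln y\<close>.
\<close>

lemma integrable_ln_fast_ratio: "integrable square_lborel (\<lambda>p. - ln (fast_ratio p))"
proof (rule integrableI_nonneg)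
  show "(\<lambda>p. - ln (fast_ratio p)) \<in> borel_measurable square_lborel"
    by (subst measurable_cong_sets[OF sets_square_lborel refl]) measurable
  show "AE p in square_lborel. 0 \<le> - ln (fast_ratio p)"
    using AE_generic by eventually_elim (use fast_ratio_bounds in \<open>simp add: less_imp_le\<close>)
  have "(\<integral>\<^sup>+p. ennreal (- ln (fast_ratio p)) \<partial>square_lborel) =
     (\<integral>\<^sup>+x. (\<integral>\<^sup>+y. ennreal (- ln (fast_ratio (x, y))) \<partial>unit_lborel) \<partial>unit_lborel)"
    by (rule nn_integral_square_lborel) measurable
  also have "\<dots> \<le> (\<integral>\<^sup>+x. (\<integral>\<^sup>+y. ennreal (- ln x) + ennreal (- ln y) \<partial>unit_lborel) \<partial>unit_lborel)"
  proof (intro nn_integral_mono_AE, use AE_unit_lborel_irrational in eventually_elim)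
    case (elim x)
    show ?case
    proof (intro nn_integral_mono_AE, use AE_unit_lborel_irrational in eventually_elim)
      fix y :: real assume y: "0 < y \<and> y < 1 \<and> y \<notin> \<rat>"
      have "generic (x, y)" using elim y by (simp add: generic_def)
      note b = fast_ratio_bounds[OF this]
      have "ln (x * y) \<le> ln (fast_ratio (x, y))" using b elim y by simp
      then have "- ln (fast_ratio (x, y)) \<le> - ln x + - ln y" using elim y by (simp add: ln_mult)
      then have "ennreal (- ln (fast_ratio (x, y))) \<le> ennreal (- ln x + - ln y)" by (rule ennreal_leI)
      also have "\<dots> = ennreal (- ln x) + ennreal (- ln y)" using elim y by (intro ennreal_plus) auto
      finally show "ennreal (- ln (fast_ratio (x, y))) \<le> ennreal (- ln x) + ennreal (- ln y)" .
    qed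
  qed
  also have "\<dots> = 1 + 1"
    by (simp add: nn_integral_add nn_integral_neg_ln emeasure_unit_lborel_UNIV)
  also have "\<dots> < \<infinity>" by simp
  finally show "(\<integral>\<^sup>+p. ennreal (- ln (fast_ratio p)) \<partial>square_lborel) < \<infinity>" .
qed

lemma finite_square_lborel: "finite_measure square_lborel"
  by (rule finite_measureI) (simp add: emeasure_square_lborel_UNIV)

lemma borel_measurable_inv_density_fst' [simp]: "(\<lambda>p. inv_density (fst p)) \<in> borel_measurable square_lborel"
proof -
  have "(\<lambda>p::real \<times> real. inv_density (fst p)) \<in> borel_measurable borel" by (rule measurable_of_pair) measurable
  then show ?thesis by (simp add: measurable_cong_sets[OF sets_square_lborel refl])
qed

lemma AE_inv_density_bound: "AE p in square_lborel. 0 \<le> inv_density (fst p)" "AE p in square_lborel. norm (inv_density (fst p)) \<le> 2"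
proof -
  have "AE p in square_lborel. 3/4 \<le> inv_density (fst p) \<and> inv_density (fst p) \<le> 2"
  proof (use AE_square_lborel in eventually_elim)
    case (elim p)
    then show ?case using inv_density_bounds[of "fst p"] by simp
  qed
  then show "AE p in square_lborel. 0 \<le> inv_density (fst p)" "AE p in square_lborel. norm (inv_density (fst p)) \<le> 2"
    by (eventually_elim; simp)+
qed

lemma integral_inv_measure:
  fixes f :: "real \<times> real \<Rightarrow> real"
  assumes f: "integrable square_lborel f"
  shows "integrable square_lborel (\<lambda>p. inv_density (fst p) * f p)"
    "integrable inv_measure f" "(\<integral>p. f p \<partial>inv_measure) = (\<integral>p. inv_density (fst p) * f p \<partial>square_lborel)"
proof -
  have fm: "f \<in> borel_measurable square_lborel" using f by simp
  show int: "integrable square_lborel (\<lambda>p. inv_density (fst p) * f p)"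
  proof (rule Bochner_Integration.integrable_bound[of _ "\<lambda>p. 2 * f p"])
    show "integrable square_lborel (\<lambda>p. 2 * f p)" using f by simp
    show "(\<lambda>p. inv_density (fst p) * f p) \<in> borel_measurable square_lborel"
      by (intro borel_measurable_times fm borel_measurable_inv_density_fst')
    show "AE p in square_lborel. norm (inv_density (fst p) * f p) \<le> norm (2 * f p)"
      using AE_inv_density_bound(2) by eventually_elim (auto simp: abs_mult intro!: mult_right_mono)
  qed
  show "integrable inv_measure f"
    unfolding inv_measure_def using int integrable_density[OF fm borel_measurable_inv_density_fst' AE_inv_density_bound(1)] by simp
  show "(\<integral>p. f p \<partial>inv_measure) = (\<integral>p. inv_density (fst p) * f p \<partial>square_lborel)"
    unfolding inv_measure_def using integral_density[OF fm borel_measurable_inv_density_fst' AE_inv_density_bound(1)] by simp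
qed

text \<open>
  The second claim is what makes the growth rate exceed 1. Since \<open>- ln fast_ratio \<ge> - ln x\<close>, it suffices to
  see that \<open>- ln x - 1\<close> has positive mean for the invariant density \<open>h\<close>. Its Lebesgue mean is 0, and
  both \<open>- ln x - 1\<close> and \<open>h x - h (1 / e)\<close> are decreasing with zero at \<open>1 / e\<close>, so their product is positive
  except at this point.
\<close>

lemma measure_inv_measure: "0 < measure inv_measure UNIV" "measure inv_measure UNIV < (\<integral>p. - ln (fast_ratio p) \<partial>inv_measure)"
proof -
  interpret U: finite_measure square_lborel by (rule finite_square_lborel)
  interpret I: finite_measure inv_measure by (rule finite_inv_measure)
  define h where "h = (\<lambda>p::real \<times> real. inv_density (fst p))"
  define c where "c = inv_density (exp (- 1))"
  let ?f = "\<lambda>p. - ln (fast_ratio p)"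
  have one: "integrable square_lborel (\<lambda>_. 1::real)" by simp
  have U1: "measure square_lborel UNIV = 1" by (simp add: measure_def emeasure_square_lborel_UNIV)
  note i1 = integral_inv_measure[OF one]
  have Z: "measure inv_measure UNIV = (\<integral>p. h p \<partial>square_lborel)" using i1(3) by (simp add: h_def)
  have hint: "integrable square_lborel h" using i1(1) by (simp add: h_def)
  note i2 = integral_inv_measure[OF integrable_ln_fast_ratio]
  have lnint: "integrable square_lborel (\<lambda>p. - ln (fst p))" "(\<integral>p. - ln (fst p) \<partial>square_lborel) = 1"
    using has_bochner_integral_neg_ln_fst by (auto simp: has_bochner_integral_iff)
  show "0 < measure inv_measure UNIV"
  proof -
    have "(\<integral>p. 0 \<partial>square_lborel) < (\<integral>p. h p \<partial>square_lborel)"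
    proof (rule U.integral_less_AE_space)
      show "AE p in square_lborel. 0 < h p" using AE_square_lborel by eventually_elim (simp add: h_def inv_density_def)
    qed (auto simp: hint emeasure_square_lborel_UNIV)
    then show ?thesis by (simp add: Z)
  qed
  have ne: "AE p in square_lborel. fst p \<notin> {exp (- 1)}"
    by (rule AE_square_lborel_fst_notin_countable) simp
  have int2: "integrable square_lborel (\<lambda>p. h p * ?f p - h p)" using i2(1) hint by (simp add: h_def)
  have int3: "integrable square_lborel (\<lambda>p. c * (- ln (fst p) - 1))" using lnint(1) by simp
  have "(\<integral>p. c * (- ln (fst p) - 1) \<partial>square_lborel) < (\<integral>p. h p * ?f p - h p \<partial>square_lborel)"
  proof (rule U.integral_less_AE_space[OF int3 int2])
    show "AE p in square_lborel. c * (- ln (fst p) - 1) < h p * ?f p - h p"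
      using AE_generic ne
    proof eventually_elim
      case (elim p)
      then have x: "0 < fst p" "fst p < 1" "fst p \<noteq> exp (- 1)" by (auto simp: generic_def)
      have "0 < (- ln (fst p) - 1) * (h p - c)"
      proof (cases "fst p < exp (- 1)")
        case True
        then have "ln (fst p) < - 1" using x by (metis exp_gt_zero ln_exp ln_less_cancel_iff)
        moreover have "c < h p" unfolding c_def h_def using True x by (intro inv_density_decreasing) auto
        ultimately show ?thesis by simp
      next
        case False
        then have "exp (- 1) < fst p" using x by simp
        then have "- 1 < ln (fst p)" using x by (metis exp_gt_zero ln_exp ln_less_cancel_iff)
        moreover have "h p < c" unfolding c_def h_def using \<open>exp (- 1) < fst p\<close> by (intro inv_density_decreasing) auto
        ultimately show ?thesis by (intro mult_neg_neg) auto
      qed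
      moreover have "h p * (- ln (fst p)) \<le> h p * ?f p"
      proof (rule mult_left_mono)
        show "- ln (fst p) \<le> ?f p" using fast_ratio_bounds[OF elim(1)] x by simp
        show "0 \<le> h p" using x by (simp add: h_def inv_density_def)
      qed
      ultimately show ?case by (simp add: algebra_simps)
    qed
  qed (simp add: emeasure_square_lborel_UNIV)
  moreover have "(\<integral>p. c * (- ln (fst p) - 1) \<partial>square_lborel) = 0"
    using lnint U1 by simp
  moreover have "(\<integral>p. h p * ?f p - h p \<partial>square_lborel) = (\<integral>p. ?f p \<partial>inv_measure) - measure inv_measure UNIV"
    using i2 hint by (simp add: Z h_def)
  ultimately show "measure inv_measure UNIV < (\<integral>p. ?f p \<partial>inv_measure)" by linarith
qed

text \<open>
  If the run is stopped by a green step it has about \<open>(1 - y) / x\<close> steps, otherwise about \<open>1 / x\<close> steps. The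
  factor 2 is a crude allowance for rounding.
\<close>

lemma red_run_lower_bound:
  assumes "generic p"
  shows "(1 - snd p) / (2 * fst p) \<le> real (red_run p) + 1"
proof -
  obtain x y where p: "p = (x, y)" by (cases p)
  have g: "generic (x, y)" using assms p by simp
  have xy: "0 < x" "x < 1" "0 \<le> y" "y \<le> 1" using g by (auto simp: generic_def)
  have "1 - y \<le> 2 * x * (real (red_run (x, y)) + 1)"
  proof (cases "ends_green (x, y)")
    case True
    have "1 - y \<le> (real (red_run (x, y)) + 1) * x" by (rule red_run_upper[OF g True])
    then show ?thesis using xy by (simp add: algebra_simps)
  next
    case False
    define z where "z = real (red_run (x, y)) * x"
    have "0 \<le> z" using xy by (simp add: z_def)
    moreover have "1 < (real (red_run (x, y)) + 2) * x"
    proof -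
      have "real (nat \<lfloor>1 / x\<rfloor>) = real (red_run (x, y)) + 1" using red_run_lower[OF g False] by linarith
      moreover have "1 < (real (nat \<lfloor>1 / x\<rfloor>) + 1) * x" by (rule floor_inverse_mult(2)[OF g])
      ultimately show ?thesis by (simp add: algebra_simps)
    qed
    then have "1 < z + 2 * x" by (simp only: z_def distrib_right)
    ultimately have "1 - y \<le> 2 * z + 2 * x" using xy by linarith
    then show ?thesis by (simp add: z_def algebra_simps)
  qed
  then show ?thesis using xy by (simp add: p divide_le_eq mult.commute mult.left_commute)
qed

text \<open>
  The expected waiting time is infinite, because \<open>1 / x\<close> is not integrable at 0. Half of each fibre is
  enough for this.
\<close>

lemma nn_integral_red_run: "(\<integral>\<^sup>+p. ennreal (real (red_run p) + 1) \<partial>inv_measure) = \<infinity>"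
proof -
  have "\<infinity> = ennreal (3/32) * (\<integral>\<^sup>+x. ennreal (1 / x) \<partial>unit_lborel)"
    by (simp add: nn_integral_inverse_top ennreal_mult_top)
  also have "\<dots> = (\<integral>\<^sup>+x. ennreal (3/32) * ennreal (1 / x) \<partial>unit_lborel)"
    by (rule nn_integral_cmult[symmetric]) measurable
  also have "\<dots> \<le> (\<integral>\<^sup>+x. (\<integral>\<^sup>+y. ennreal (real (red_run (x, y)) + 1) * ennreal (inv_density x) \<partial>unit_lborel) \<partial>unit_lborel)"
  proof (intro nn_integral_mono_AE, use AE_unit_lborel_irrational in eventually_elim)
    case (elim x)
    have half: "(\<integral>\<^sup>+y. indicator {0..1/2} y \<partial>unit_lborel) = ennreal (1/2)"
    proof -
      have "indicator {0..1/2} y * indicator {0..1} y = (indicator {0..1/2} y :: ennreal)" for y :: real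
        by (auto simp: indicator_def)
      then show ?thesis by (subst nn_integral_unit_lborel) auto
    qed
    have "3/32 * (1 / x) = 3 / (16 * x) * (1/2)" by simp
    then have "ennreal (3/32) * ennreal (1 / x) = ennreal (3 / (16 * x)) * ennreal (1/2)"
      using elim by (subst (1 2) ennreal_mult'[symmetric]) simp_all
    also have "\<dots> = (\<integral>\<^sup>+y. ennreal (3 / (16 * x)) * indicator {0..1/2} y \<partial>unit_lborel)"
      unfolding half[symmetric] by (rule nn_integral_cmult[symmetric]) simp
    also have "\<dots> \<le> (\<integral>\<^sup>+y. ennreal (real (red_run (x, y)) + 1) * ennreal (inv_density x) \<partial>unit_lborel)"
    proof (intro nn_integral_mono_AE, use AE_unit_lborel_irrational in eventually_elim)
      fix y :: real assume y: "0 < y \<and> y < 1 \<and> y \<notin> \<rat>"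
      have g: "generic (x, y)" using elim y by (simp add: generic_def)
      show "ennreal (3 / (16 * x)) * indicator {0..1/2} y \<le> ennreal (real (red_run (x, y)) + 1) * ennreal (inv_density x)"
      proof (cases "y \<le> 1/2")
        case True
        have "1 / (4 * x) \<le> (1 - y) / (2 * x)" using True elim by (simp add: field_simps)
        also have "\<dots> \<le> real (red_run (x, y)) + 1" using red_run_lower_bound[OF g] by simp
        finally have "1 / (4 * x) * (3/4) \<le> (real (red_run (x, y)) + 1) * inv_density x"
          using elim by (intro mult_mono inv_density_bounds) auto
        then have "ennreal (3 / (16 * x)) \<le> ennreal ((real (red_run (x, y)) + 1) * inv_density x)"
          by (intro ennreal_leI) simp
        also have "\<dots> = ennreal (real (red_run (x, y)) + 1) * ennreal (inv_density x)" by (rule ennreal_mult') simp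
        finally show ?thesis using True y by (simp add: indicator_def)
      qed (simp add: indicator_def)
    qed
    finally show ?case .
  qed
  also have "\<dots> = (\<integral>\<^sup>+p. ennreal (real (red_run p) + 1) * ennreal (inv_density (fst p)) \<partial>square_lborel)"
  proof -
    have "(\<lambda>p. ennreal (real (red_run p) + 1) * ennreal (inv_density (fst p))) \<in> borel_measurable borel"
      by (intro borel_measurable_times_ennreal borel_measurable_inv_density_fst) measurable
    from nn_integral_square_lborel[OF this] show ?thesis by (simp only: fst_conv)
  qed
  also have "\<dots> = (\<integral>\<^sup>+p. ennreal (real (red_run p) + 1) \<partial>inv_measure)"
    by (rule nn_integral_inv_measure[symmetric]) measurable
  finally show ?thesis by (simp add: top_unique)
qed

section \<open>Almost everywhere limits\<close>

lemma AE_lebesgue_on_square: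
  assumes "AE p in square_lborel. P p"
  shows "AE p in lebesgue_on ({0..1} \<times> {0..1}). P p"
proof -
  have sq: "{0..1::real} \<times> {0..1::real} \<in> sets borel" by (intro borel_closed closed_Times) auto
  have "AE p in lborel. 0 < (indicator ({0..1} \<times> {0..1}) p :: ennreal) \<longrightarrow> P p"
    using assms unfolding square_lborel_def by (subst (asm) AE_density) (simp_all add: sq borel_measurable_indicator)
  then have "AE p in lborel. p \<in> {0..1} \<times> {0..1} \<longrightarrow> P p"
    by (rule eventually_mono) (simp add: indicator_def)
  then have "AE p in lebesgue. p \<in> {0..1} \<times> {0..1} \<longrightarrow> P p" by (rule AE_completion)
  moreover have "{0..1} \<times> {0..1} \<inter> space lebesgue \<in> sets (lebesgue :: (real \<times> real) measure)"
    using sq by (simp add: sets_completionI_sets)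
  ultimately show ?thesis by (subst AE_restrict_space_iff) auto
qed

lemma fast_map_measurable: "fast_map \<in> measurable inv_measure inv_measure"
  using borel_measurable_fast_map by (simp add: measurable_cong_sets[OF sets_inv_measure sets_inv_measure])

lemma AE_fast_map_averages:
  assumes "integrable inv_measure f"
  shows "AE p in square_lborel. (\<lambda>k. (\<Sum>j<k. f ((fast_map ^^ j) p)) / k) \<longlonglongrightarrow>
    (\<integral>p. f p \<partial>inv_measure) / measure inv_measure UNIV"
proof -
  have "AE p in inv_measure. (\<lambda>k. (\<Sum>j<k. f ((fast_map ^^ j) p)) / k) \<longlonglongrightarrow>
    (\<integral>p. f p \<partial>inv_measure) / measure inv_measure (space inv_measure)"
  proof (rule birkhoff_ergodic[OF finite_inv_measure fast_map_measurable fast_map_preserves_inv_measure])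
    fix A assume A: "A \<in> sets inv_measure" "fast_map -` A \<inter> space inv_measure = A"
    have null: "emeasure inv_measure B = 0" if "emeasure square_lborel B = 0" "B \<in> sets borel" for B
    proof -
      have "AE p in square_lborel. p \<notin> B" using that by (intro AE_not_in) (simp add: null_sets_def)
      then have "AE p in inv_measure. p \<notin> B" by (simp only: AE_inv_measure)
      then show ?thesis using emeasure_eq_0_AE[of "\<lambda>p. p \<in> B" inv_measure] by simp
    qed
    have "A \<in> sets borel" "fast_map -` A = A" using A by simp_all
    then show "emeasure inv_measure A = 0 \<or> emeasure inv_measure (space inv_measure - A) = 0"
      using fast_map_ergodic[of A] null[of A] null[of "- A"] by (auto simp: Compl_eq_Diff_UNIV)
  qed (use assms measure_inv_measure in simp_all)
  then show ?thesis by (simp only: AE_inv_measure space_inv_measure)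
qed

definition growth_rate :: real where
  "growth_rate = (\<integral>p. - ln (fast_ratio p) \<partial>inv_measure) / measure inv_measure UNIV"

lemma growth_rate_gt_1: "1 < growth_rate"
  using measure_inv_measure unfolding growth_rate_def by (simp only: less_divide_eq_1_pos)

lemma AE_qbar_growth:
  "AE p in square_lborel. (\<lambda>k. 1 / real k * ln (real_of_int (qbar p k))) \<longlonglongrightarrow> growth_rate"
  using AE_fast_map_averages[OF integral_inv_measure(2)[OF integrable_ln_fast_ratio]] AE_generic
proof eventually_elim
  case (elim p)
  let ?S = "\<lambda>k. \<Sum>j<k. - ln (fast_ratio ((fast_map ^^ j) p))"
  have "(\<lambda>k. 1 / real k * ln (real_of_int (qbar p k)) - ?S k / k) \<longlonglongrightarrow> 0"
  proof (rule Lim_null_comparison)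
    show "(\<lambda>k. ln 2 * inverse (real k)) \<longlonglongrightarrow> 0" by (intro tendsto_mult_right_zero lim_inverse_n)
    show "\<forall>\<^sub>F k in sequentially. norm (1 / real k * ln (real_of_int (qbar p k)) - ?S k / k) \<le> ln 2 * inverse (real k)"
    proof (intro always_eventually allI)
      fix k
      have "1 / real k * ln (real_of_int (qbar p k)) - ?S k / k = (ln (real_of_int (qbar p k)) - ?S k) * inverse (real k)"
        by (simp add: divide_inverse right_diff_distrib mult.commute)
      also have "norm \<dots> \<le> ln 2 * inverse (real k)"
        using mult_right_mono[OF ln_qbar_approx(2)[OF elim(2), of k], of "inverse (real k)"]
        by (simp only: real_norm_def abs_mult abs_inverse abs_of_nat inverse_nonnegative_iff_nonnegative of_nat_0_le_iff)
      finally show "norm (1 / real k * ln (real_of_int (qbar p k)) - ?S k / k) \<le> ln 2 * inverse (real k)" .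
    qed
  qed
  from tendsto_add[OF this elim(1)] show ?case by (simp add: growth_rate_def)
qed

text \<open>
  The waiting time itself is not integrable, so its averages are controlled through truncations.
\<close>

lemma truncated_red_run:
  "integrable inv_measure (\<lambda>p. min (real (red_run p) + 1) (real K))"
  "\<exists>K. B < (\<integral>p. min (real (red_run p) + 1) (real K) \<partial>inv_measure)"
proof -
  interpret finite_measure inv_measure by (rule finite_inv_measure)
  let ?w = "\<lambda>K p. min (real (red_run p) + 1) (real K)"
  have wm: "?w K \<in> borel_measurable inv_measure" for K
    by (subst measurable_cong_sets[OF sets_inv_measure refl]) measurable
  show int: "integrable inv_measure (?w K)" for K
    by (rule integrable_const_bound[of _ "real K"]) (auto simp: wm)
  have "(\<integral>\<^sup>+p. ennreal (real (red_run p) + 1) \<partial>inv_measure) = (\<integral>\<^sup>+p. (SUP K. ennreal (?w K p)) \<partial>inv_measure)"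
  proof (rule nn_integral_cong)
    fix p
    show "ennreal (real (red_run p) + 1) = (SUP K. ennreal (?w K p))"
    proof (rule antisym)
      have "ennreal (real (red_run p) + 1) = ennreal (?w (Suc (red_run p)) p)" by simp
      also have "\<dots> \<le> (SUP K. ennreal (?w K p))" by (rule SUP_upper) simp
      finally show "ennreal (real (red_run p) + 1) \<le> (SUP K. ennreal (?w K p))" .
      show "(SUP K. ennreal (?w K p)) \<le> ennreal (real (red_run p) + 1)"
        by (rule SUP_least) (rule ennreal_leI, simp)
    qed
  qed
  also have "\<dots> = (SUP K. \<integral>\<^sup>+p. ennreal (?w K p) \<partial>inv_measure)"
    using wm by (intro nn_integral_monotone_convergence_SUP) (auto simp: incseq_def le_fun_def intro!: ennreal_leI min.mono)
  finally have sup: "(SUP K. \<integral>\<^sup>+p. ennreal (?w K p) \<partial>inv_measure) = \<infinity>" by (simp only: nn_integral_red_run)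
  have "ennreal (max B 0) < (SUP K. \<integral>\<^sup>+p. ennreal (?w K p) \<partial>inv_measure)" unfolding sup by simp
  then obtain K where "ennreal (max B 0) < (\<integral>\<^sup>+p. ennreal (?w K p) \<partial>inv_measure)" by (auto simp: less_SUP_iff)
  also have "\<dots> = ennreal (\<integral>p. ?w K p \<partial>inv_measure)" by (intro nn_integral_eq_integral int) auto
  finally have "max B 0 < (\<integral>p. ?w K p \<partial>inv_measure)" by (subst (asm) ennreal_less_iff) auto
  then show "\<exists>K. B < (\<integral>p. ?w K p \<partial>inv_measure)" by (intro exI[of _ K]) simp
qed

lemma strict_mono_nidx: "strict_mono (nidx p)"
  by (rule strict_monoI_Suc) simp

text \<open>
  At fast times \<open>ln q\<close> grows linearly in \<open>k\<close>, whereas the number of slow steps grows faster than any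
  multiple of \<open>k\<close>. Along this subsequence \<open>q / C ^ n\<close> therefore tends to 0.
\<close>

lemma AE_liminf_q:
  fixes C :: real
  assumes C: "1 < C"
  shows "AE p in square_lborel. liminf (\<lambda>n. ereal (real_of_int (q p n) / C ^ n)) = 0"
proof -
  define Z where "Z = measure inv_measure UNIV"
  have Z: "0 < Z" unfolding Z_def by (rule measure_inv_measure)
  have lnC: "0 < ln C" using C by simp
  \<comment> \<open>one unit of the margin absorbs the error in the limit for \<open>ln qbar\<close>, the other produces the decay \<open>exp (- k)\<close>\<close>
  obtain K where K: "(growth_rate + 2) / ln C * Z < (\<integral>p. min (real (red_run p) + 1) (real K) \<partial>inv_measure)"
    using truncated_red_run(2) by blast
  define w where "w p = min (real (red_run p) + 1) (real K)" for p
  have rate: "(growth_rate + 2) / ln C < (\<integral>p. w p \<partial>inv_measure) / Z"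
    using K Z by (simp add: w_def less_divide_eq)
  have "AE p in square_lborel. (\<lambda>k. (\<Sum>j<k. w ((fast_map ^^ j) p)) / k) \<longlonglongrightarrow> (\<integral>p. w p \<partial>inv_measure) / Z"
    unfolding Z_def w_def by (rule AE_fast_map_averages[OF truncated_red_run(1)])
  with AE_qbar_growth AE_generic show ?thesis
  proof eventually_elim
    case (elim p)
    note p = elim(2)
    define Y where "Y n = real_of_int (q p n) / C ^ n" for n
    have Y_nonneg: "0 \<le> Y n" for n using q_nonneg[OF p] C by (simp add: Y_def)
    have "eventually (\<lambda>k. 1 / real k * ln (real_of_int (qbar p k)) < growth_rate + 1) sequentially"
      using elim(1) by (rule order_tendstoD) simp
    moreover have "eventually (\<lambda>k. (growth_rate + 2) / ln C < (\<Sum>j<k. w ((fast_map ^^ j) p)) / k) sequentially"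
      using elim(3) rate by (rule order_tendstoD)
    ultimately have "eventually (\<lambda>k. norm (Y (nidx p k)) \<le> exp (- real k)) sequentially"
      using eventually_gt_at_top[of 0]
    proof eventually_elim
      case (elim k)
      have 1: "ln (real_of_int (qbar p k)) < (growth_rate + 1) * k" using elim by (simp add: divide_less_eq)
      have "(growth_rate + 2) * k < ln C * (\<Sum>j<k. w ((fast_map ^^ j) p))"
        using elim lnC by (simp add: field_simps)
      also have "\<dots> \<le> ln C * (\<Sum>j<k. real (red_run ((fast_map ^^ j) p)) + 1)"
        using lnC by (intro mult_left_mono sum_mono) (auto simp: w_def)
      also have "(\<Sum>j<k. real (red_run ((fast_map ^^ j) p)) + 1) = real (nidx p k)"
        unfolding T_fast_orbit(3)[OF p] by (simp add: add.commute)
      finally have 2: "(growth_rate + 2) * k < ln C * real (nidx p k)" .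
      have qpos: "0 < qbar p k" by (rule ln_qbar_approx(1)[OF p])
      then have Ypos: "0 < Y (nidx p k)" using C by (simp add: Y_def qbar_def)
      have "ln (Y (nidx p k)) = ln (real_of_int (qbar p k)) - real (nidx p k) * ln C"
        using qpos C by (simp add: Y_def qbar_def ln_div ln_realpow)
      also have "\<dots> \<le> - real k" using 1 2 by (simp add: algebra_simps)
      finally have "exp (ln (Y (nidx p k))) \<le> exp (- real k)" by simp
      then show ?case using Ypos by simp
    qed
    moreover have "(\<lambda>k. exp (- real k)) \<longlonglongrightarrow> 0" by real_asymp
    ultimately have "(\<lambda>k. Y (nidx p k)) \<longlonglongrightarrow> 0" by (rule Lim_null_comparison)
    then have "(\<lambda>k. ereal (Y (nidx p k))) \<longlonglongrightarrow> ereal 0" by (rule tendsto_ereal)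
    then have "liminf ((\<lambda>n. ereal (Y n)) \<circ> nidx p) = 0"
      by (intro lim_imp_Liminf) (auto simp: comp_def zero_ereal_def)
    moreover have "liminf (\<lambda>n. ereal (Y n)) \<le> liminf ((\<lambda>n. ereal (Y n)) \<circ> nidx p)"
      by (rule liminf_subseq_mono[OF strict_mono_nidx])
    moreover have "0 \<le> liminf (\<lambda>n. ereal (Y n))"
      by (rule Liminf_bounded) (simp add: Y_nonneg)
    ultimately have "liminf (\<lambda>n. ereal (Y n)) = 0" by (simp only: antisym)
    then show ?case by (simp only: Y_def)
  qed
qed

theorem theorem4p2:
  shows "(\<exists>C::real. C > 1 \<and>
            (AE p in lebesgue_on ({0..1} \<times> {0..1}).
               (\<lambda>k. 1 / real k * ln (real_of_int (qbar p k))) \<longlonglongrightarrow> C)) \<and>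
         (\<forall>C::real. C > 1 \<longrightarrow>
            (AE p in lebesgue_on ({0..1} \<times> {0..1}).
               liminf (\<lambda>n. ereal (real_of_int (q p n) / C ^ n)) = 0))"
proof (intro conjI allI impI exI)
  show "growth_rate > 1" by (rule growth_rate_gt_1)
  show "AE p in lebesgue_on ({0..1} \<times> {0..1}).
      (\<lambda>k. 1 / real k * ln (real_of_int (qbar p k))) \<longlonglongrightarrow> growth_rate"
    by (rule AE_lebesgue_on_square[OF AE_qbar_growth])
next
  fix C :: real assume "C > 1"
  then show "AE p in lebesgue_on ({0..1} \<times> {0..1}).
      liminf (\<lambda>n. ereal (real_of_int (q p n) / C ^ n)) = 0"
    by (intro AE_lebesgue_on_square AE_liminf_q)
qed

end
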